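(* There exists a nonempty $\Pi^0_1$ class of Borel probability measures on $2^{\mathbb N}$ all of whose elements are neutral measures.
   Context: $2^{<\mathbb N}$ is the set of finite binary strings; for a Borel probability measure $\mu$ on $2^{\mathbb N}$ write $\mu(\sigma)=\mu([\sigma])$. A semimeasure is a function $f:2^{<\mathbb N}\to[0,1]$ with $f(\sigma)\ge f(\sigma\,\hat{}\,0)+f(\sigma\,\hat{}\,1)$; its undergraph is $\{(\sigma,q)\in2^{<\mathbb N}\times\mathbb Q: f(\sigma)>q\}$. A c.e. test is a computably enumerable set $T$ of elements $\big((\sigma_i,q_i)_{i<k},(\sigma,q)\big)\in(2^{<\mathbb N}\times\mathbb Q)^{<\mathbb N}\times(2^{<\mathbb N}\times\mathbb Q)$ such that for every Borel probability measure $\mu$ the set of $(\sigma,q)$ for which some $\big((\sigma_i,q_i)_{i<k},(\sigma,q)\big)\in T$ has $\mu(\sigma_i)>q_i$ for all $i<k$ is the undergraph of a semimeasure, denoted $T(\mu)$. A c.e. test $U$ is universal if for every c.e. test $T$ there is a rational $c>0$ with $U(\mu)(\sigma)\ge c\,T(\mu)(\sigma)$ for all $\mu,\sigma$. $\mu$ passes $T$ if $T(\mu)(\sigma)\le\mu(\sigma)$ for all $\sigma$; $\mu$ is neutral if it passes a universal c.e. test. A $\Pi^0_1$ class of measures is a set of Borel probability measures on $2^{\mathbb N}$ whose complement is the union of a computably enumerable family of basic open sets of the form $\{\mu:p_i<\mu(\sigma_i)<q_i,\ i=1,\dots,m\}$ with $\sigma_i\in2^{<\mathbb N}$ and $p_i<q_i$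 rational. *)

theory Defs
  imports "HOL-Probability.Probability" "HOL-Library.Nat_Bijection"
begin

section \<open>Partial recursive functions and computable enumerability\<close>

text \<open>
  Kleene's partial recursive functions. Terms carry no arity: a term denotes a partial function
  on argument lists, and its restriction to lists of length \<open>k\<close> is a \<open>k\<close>-ary partial recursive
  function (possibly nowhere defined). Composition is strict, and unbounded minimization requires
  all earlier values to be defined and nonzero. The recursion variable of \<open>PrimRec\<close> and
  the search variable of \<open>Mu\<close> come first in the argument list.
\<close>

datatype recf =
    Zero
  | Succ
  | Proj nat
  | Comp recf "recf list"
  | PrimRec recf recf
  | Mu recf

fun reval :: "recf \<Rightarrow> nat list \<Rightarrow> nat option" where
  "reval Zero xs = Some 0"
| "reval Succ xs = (case xs of [x] \<Rightarrow> Some (Suc x) | _ \<Rightarrow> None)"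
| "reval (Proj i) xs = (if i < length xs then Some (xs ! i) else None)"
| "reval (Comp f gs) xs = Option.bind (those (map (\<lambda>g. reval g xs) gs)) (\<lambda>ys. reval f ys)"
| "reval (PrimRec f g) xs =
     (case xs of
        [] \<Rightarrow> None
      | n # ys \<Rightarrow>
          rec_nat (reval f ys) (\<lambda>m r. Option.bind r (\<lambda>y. reval g (m # y # ys))) n)"
| "reval (Mu f) xs =
     (if \<exists>n. reval f (n # xs) = Some 0 \<and> (\<forall>m<n. \<exists>y>0. reval f (m # xs) = Some y)
      then Some (LEAST n. reval f (n # xs) = Some 0)
      else None)"

definition ce :: "nat set \<Rightarrow> bool" where
  "ce A \<longleftrightarrow> (\<exists>f. A = {n. reval f [n] \<noteq> None})"

text \<open>
  Sets of finite objects are called c.e. with respect to standard injective, effective codings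
  by natural numbers. A rational is coded by its reduced fraction with positive denominator.
\<close>

definition code_string :: "bool list \<Rightarrow> nat" where
  "code_string \<sigma> = list_encode (map of_bool \<sigma>)"

definition code_rat :: "rat \<Rightarrow> nat" where
  "code_rat q = (case quotient_of q of (a, b) \<Rightarrow> prod_encode (int_encode a, int_encode b))"

definition code_pair :: "bool list \<times> rat \<Rightarrow> nat" where
  "code_pair = (\<lambda>(\<sigma>, q). prod_encode (code_string \<sigma>, code_rat q))"

definition code_rule :: "(bool list \<times> rat) list \<times> (bool list \<times> rat) \<Rightarrow> nat" where
  "code_rule = (\<lambda>(ps, c). prod_encode (list_encode (map code_pair ps), code_pair c))"

definition code_box :: "(bool list \<times> rat \<times> rat) list \<Rightarrow> nat" where
  "code_box w =
     list_encode (map (\<lambda>(\<sigma>, p, q). prod_encode (code_string \<sigma>, prod_encode (code_rat p, code_rat q))) w)"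

lemma inj_code_string: "inj code_string"
proof (rule injI)
  fix \<sigma> \<tau> assume "code_string \<sigma> = code_string \<tau>"
  moreover have "inj (of_bool :: bool \<Rightarrow> nat)" by (auto intro!: injI simp: of_bool_def split: if_splits)
  ultimately show "\<sigma> = \<tau>"
    by (simp add: code_string_def list_encode_eq inj_map_eq_map)
qed

lemma inj_code_rat: "inj code_rat"
  by (rule injI)
     (auto simp: code_rat_def prod_encode_eq int_encode_eq quotient_of_inject_eq[symmetric]
           split: prod.splits)

lemma inj_code_pair: "inj code_pair"
  by (auto intro!: injI simp: code_pair_def prod_encode_eq
        dest: injD[OF inj_code_string] injD[OF inj_code_rat])

lemma inj_code_rule: "inj code_rule"
  by (auto intro!: injI simp: code_rule_def prod_encode_eq list_encode_eq
        inj_map_eq_map[OF inj_code_pair] dest: injD[OF inj_code_pair])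

lemma inj_code_box: "inj code_box"
proof -
  have "inj (\<lambda>(\<sigma>, p, q). prod_encode (code_string \<sigma>, prod_encode (code_rat p, code_rat q)))"
    by (auto intro!: injI simp: prod_encode_eq
          dest: injD[OF inj_code_string] injD[OF inj_code_rat])
  then show ?thesis
    by (auto intro!: injI simp: code_box_def list_encode_eq inj_map_eq_map)
qed

section \<open>Borel probability measures on Cantor space\<close>

text \<open>Here \<open>borel\<close> refers to the product topology on \<open>nat \<Rightarrow> bool\<close>, with \<open>bool\<close> discrete.\<close>

definition borel_prob :: "(nat \<Rightarrow> bool) measure \<Rightarrow> bool" where
  "borel_prob \<mu> \<longleftrightarrow> prob_space \<mu> \<and> sets \<mu> = sets borel"

definition cylinder :: "bool list \<Rightarrow> (nat \<Rightarrow> bool) set" where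
  "cylinder \<sigma> = {x. \<forall>i<length \<sigma>. x i = \<sigma> ! i}"

lemma cylinder_borel: "cylinder \<sigma> \<in> sets borel"
proof -
  have "open ((\<lambda>x :: nat \<Rightarrow> bool. x i) -` {b})" for i b
    by (rule open_vimage[OF discrete_topology_class.open_discrete]) simp
  then have "open (\<Inter>i\<in>{..<length \<sigma>}. (\<lambda>x :: nat \<Rightarrow> bool. x i) -` {\<sigma> ! i})"
    by blast
  moreover have "cylinder \<sigma> = (\<Inter>i\<in>{..<length \<sigma>}. (\<lambda>x. x i) -` {\<sigma> ! i})"
    by (auto simp: cylinder_def)
  ultimately show ?thesis by simp
qed

abbreviation cyl_measure :: "(nat \<Rightarrow> bool) measure \<Rightarrow> bool list \<Rightarrow> real" where
  "cyl_measure \<mu> \<sigma> \<equiv> measure \<mu> (cylinder \<sigma>)"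

section \<open>C.e. tests and neutral measures\<close>

definition semimeasure :: "(bool list \<Rightarrow> real) \<Rightarrow> bool" where
  "semimeasure f \<longleftrightarrow>
     (\<forall>\<sigma>. 0 \<le> f \<sigma> \<and> f \<sigma> \<le> 1 \<and> f \<sigma> \<ge> f (\<sigma> @ [False]) + f (\<sigma> @ [True]))"

definition undergraph :: "(bool list \<Rightarrow> real) \<Rightarrow> (bool list \<times> rat) set" where
  "undergraph f = {(\<sigma>, q). f \<sigma> > of_rat q}"

lemma undergraph_inject: "undergraph f = undergraph g \<Longrightarrow> f = g"
proof (rule ext)
  fix \<sigma> assume eq: "undergraph f = undergraph g"
  then have *: "f \<sigma> > of_rat q \<longleftrightarrow> g \<sigma> > of_rat q" for q
    by (auto simp: undergraph_def set_eq_iff)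
  show "f \<sigma> = g \<sigma>"
  proof (rule linorder_cases[of "f \<sigma>" "g \<sigma>"])
    assume "f \<sigma> < g \<sigma>"
    then show ?thesis using of_rat_dense[of "f \<sigma>" "g \<sigma>"] * by force
  next
    assume "g \<sigma> < f \<sigma>"
    then show ?thesis using of_rat_dense[of "g \<sigma>" "f \<sigma>"] * by force
  qed
qed

type_synonym test = "((bool list \<times> rat) list \<times> (bool list \<times> rat)) set"

definition test_set :: "test \<Rightarrow> (nat \<Rightarrow> bool) measure \<Rightarrow> (bool list \<times> rat) set" where
  "test_set T \<mu> =
     {c. \<exists>ps. (ps, c) \<in> T \<and> (\<forall>(\<sigma>, q)\<in>set ps. cyl_measure \<mu> \<sigma> > of_rat q)}"

definition ce_test :: "test \<Rightarrow> bool" where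
  "ce_test T \<longleftrightarrow> ce (code_rule ` T) \<and>
     (\<forall>\<mu>. borel_prob \<mu> \<longrightarrow> (\<exists>f. semimeasure f \<and> test_set T \<mu> = undergraph f))"

text \<open>The semimeasure \<open>T(\<mu>)\<close>; it is unique by \<open>undergraph_inject\<close>.\<close>

definition test_value :: "test \<Rightarrow> (nat \<Rightarrow> bool) measure \<Rightarrow> bool list \<Rightarrow> real" where
  "test_value T \<mu> = (THE f. semimeasure f \<and> test_set T \<mu> = undergraph f)"

definition universal_ce_test :: "test \<Rightarrow> bool" where
  "universal_ce_test U \<longleftrightarrow> ce_test U \<and>
     (\<forall>T. ce_test T \<longrightarrow>
        (\<exists>c::rat. c > 0 \<and>
           (\<forall>\<mu> \<sigma>. borel_prob \<mu> \<longrightarrow> test_value U \<mu> \<sigma> \<ge> of_rat c * test_value T \<mu> \<sigma>)))"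

definition passes :: "(nat \<Rightarrow> bool) measure \<Rightarrow> test \<Rightarrow> bool" where
  "passes \<mu> T \<longleftrightarrow> (\<forall>\<sigma>. test_value T \<mu> \<sigma> \<le> cyl_measure \<mu> \<sigma>)"

definition neutral :: "(nat \<Rightarrow> bool) measure \<Rightarrow> bool" where
  "neutral \<mu> \<longleftrightarrow> borel_prob \<mu> \<and> (\<exists>U. universal_ce_test U \<and> passes \<mu> U)"

section \<open>Effectively closed classes of measures\<close>

definition basic_open :: "(bool list \<times> rat \<times> rat) list \<Rightarrow> (nat \<Rightarrow> bool) measure set" where
  "basic_open w =
     {\<mu>. borel_prob \<mu> \<and>
         (\<forall>(\<sigma>, p, q)\<in>set w. of_rat p < cyl_measure \<mu> \<sigma> \<and> cyl_measure \<mu> \<sigma> < of_rat q)}"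

definition pi01_class :: "(nat \<Rightarrow> bool) measure set \<Rightarrow> bool" where
  "pi01_class P \<longleftrightarrow> P \<subseteq> Collect borel_prob \<and>
     (\<exists>W. ce (code_box ` W) \<and> (\<forall>w\<in>W. \<forall>(\<sigma>, p, q)\<in>set w. p < q) \<and>
          Collect borel_prob - P = (\<Union>w\<in>W. basic_open w))"

end

theory Submission
  imports Defs "HOL-Library.Sublist"
begin

text \<open>
  A universal test is obtained from a uniform enumeration of all c.e. sets of rules by letting a stage
  of an enumeration through only while it is consistent, meaning that heads demanding mass more
  than 1 have jointly unsatisfiable premises. This is decidable: strict lower bounds on cylinder
  masses are unsatisfiable iff some antichain of them sums to at least 1. The trimmed sets are
  then added with weights \<open>1 / 2 ^ (e + 1)\<close>, a finite sum over antichains at a time.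

  The measures passing a test \<open>T\<close> form a \<open>\<Pi>\<^sup>0\<^sub>1\<close> class, since failing is witnessed by a single rule. For
  nonemptiness, parametrize measures by conditional probabilities in the cube \<open>[0, 1]\<^sup>\<omega>\<close>.
  The lower semicontinuous map \<open>\<mu> \<mapsto> T(\<mu>)\<close> is a supremum of Lipschitz semimeasure-valued maps; each of
  these extends continuously to a measure-valued map, for which the Poincare-Miranda theorem yields a
  fixed point, and compactness of the cube passes to the limit.
\<close>

section \<open>Arithmetic by partial recursive functions\<close>

text \<open>Being a c.e. test quantifies over all measures; the finite condition
  \<open>consistent\<close> replaces that quantifier. Every finite part of a genuine test satisfies
  it, so trimming leaves genuine tests intact. A trimmed set need not be a test itself: it only
  ensures that incomparable heads with valid premises demand total mass at most 1, and suprema of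
  weighted antichain sums then produce a semimeasure. Conditional probabilities serve as coordinates
  because they vary independently, which gives every coordinate the pair of opposite faces that
  Poincare-Miranda asks for. They are undetermined at nodes of mass 0, so the fixed point equation
  is written without division. A lower semicontinuous map may jump, so it is approximated from below
  before the missing mass is filled in continuously. Recursion-theoretic facts concern concrete
  terms of type \<open>recf\<close>. Closure rules for computable functions and semidecidable
  predicates on coded types reduce them to the syntactic form of a definition, which is why several
  notions are phrased with bounded quantifiers over lists or suffixes.\<close>

fun recf_const :: "nat \<Rightarrow> recf" where
  "recf_const 0 = Zero"
| "recf_const (Suc n) = Comp Succ [recf_const n]"

lemma reval_const [simp]: "reval (recf_const n) xs = Some n"
  by (induction n) auto

definition "recf_add = PrimRec (Proj 0) (Comp Succ [Proj 1])"
definition "recf_pred = PrimRec Zero (Proj 0)"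
text \<open>Truncated subtraction recurses on the subtrahend, while \<open>PrimRec\<close> recurses
  on its first argument; hence the swap.\<close>

definition "recf_diff = Comp (PrimRec (Proj 0) (Comp recf_pred [Proj 1])) [Proj 1, Proj 0]"
definition "recf_triangle = PrimRec Zero (Comp recf_add [Comp Succ [Proj 0], Proj 1])"
definition "recf_prod_encode = Comp recf_add [Comp recf_triangle [recf_add], Proj 0]"
text \<open>Since \<open>prod_encode (a, b) = triangle (a + b) + a\<close>, the diagonal
  \<open>a + b\<close> of \<open>n\<close> is the least \<open>d\<close> with
  \<open>n < triangle (Suc d)\<close>; subtracting its triangle number then yields \<open>a\<close>,
  and \<open>b\<close> after that.\<close>

definition "recf_diagonal = Mu (Comp recf_diff [Comp Succ [Proj 1], Comp recf_triangle [Comp Succ [Proj 0]]])"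
definition "recf_prod_fst = Comp recf_diff [Proj 0, Comp recf_triangle [recf_diagonal]]"
definition "recf_prod_snd = Comp recf_diff [recf_diagonal, recf_prod_fst]"

lemma reval_add [simp]: "reval recf_add [m, n] = Some (m + n)"
  unfolding recf_add_def by (induction m) auto

lemma reval_pred [simp]: "reval recf_pred [n] = Some (n - 1)"
  unfolding recf_pred_def by (cases n) (simp_all, induct_tac nat, auto)

lemma reval_diff [simp]: "reval recf_diff [m, n] = Some (m - n)"
proof -
  have "reval (PrimRec (Proj 0) (Comp recf_pred [Proj 1])) [n, m] = Some (m - n)"
    by (induction n) auto
  then show ?thesis by (simp add: recf_diff_def)
qed

lemma reval_triangle [simp]: "reval recf_triangle [n] = Some (triangle n)"
  unfolding recf_triangle_def by (induction n) (auto simp: add_ac)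

lemma reval_prod_encode [simp]: "reval recf_prod_encode [m, n] = Some (prod_encode (m, n))"
  by (simp add: recf_prod_encode_def prod_encode_def)

lemma triangle_strict_mono: "m < n \<Longrightarrow> triangle m < triangle n"
  by (induction n) (auto simp: less_Suc_eq)

lemma reval_Mu_total:
  assumes "\<And>n. reval f (n # xs) = Some (h n)" "\<exists>n. h n = 0"
  shows "reval (Mu f) xs = Some (LEAST n. h n = 0)"
proof -
  obtain n where "h n = 0" "\<forall>m<n. h m \<noteq> 0"
    using assms(2) exists_least_iff[of "\<lambda>n. h n = 0"] by blast
  then have "\<exists>n. h n = 0 \<and> (\<forall>m<n. \<exists>y>0. h m = y)" by auto
  then show ?thesis by (simp add: assms(1))
qed

lemma triangle_prod_decode: "triangle (fst (prod_decode n) + snd (prod_decode n)) + fst (prod_decode n) = n"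
  using prod_decode_inverse[of n] by (simp add: prod_encode_def case_prod_unfold)

lemma reval_diagonal [simp]: "reval recf_diagonal [n] = Some (fst (prod_decode n) + snd (prod_decode n))"
proof -
  define a b where "a = fst (prod_decode n)" and "b = snd (prod_decode n)"
  have n: "triangle (a + b) + a = n"
    by (simp add: a_def b_def triangle_prod_decode)
  have "(LEAST d. Suc n - triangle (Suc d) = 0) = a + b"
  proof (rule Least_equality)
    show "Suc n - triangle (Suc (a + b)) = 0" using n by simp
    fix d assume "Suc n - triangle (Suc d) = 0"
    then have "triangle (a + b) < triangle (Suc d)" using n by linarith
    then show "a + b \<le> d"
      using triangle_strict_mono[of "Suc d" "a + b"] by (cases "Suc d" "a + b" rule: linorder_cases) (auto simp del: triangle_Suc)
  qed
  moreover have "reval recf_diagonal [n] = Some (LEAST d. Suc n - triangle (Suc d) = 0)"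
    unfolding recf_diagonal_def
  proof (rule reval_Mu_total)
    show "\<exists>d. Suc n - triangle (Suc d) = 0" using n by (intro exI[of _ "a + b"]) simp
  qed simp
  ultimately show ?thesis by (simp add: a_def b_def)
qed

lemma reval_prod_fst [simp]: "reval recf_prod_fst [n] = Some (fst (prod_decode n))"
  using triangle_prod_decode[of n] by (simp add: recf_prod_fst_def)

lemma reval_prod_snd [simp]: "reval recf_prod_snd [n] = Some (snd (prod_decode n))"
  by (simp add: recf_prod_snd_def)

section \<open>Computable functions between coded types\<close>

text \<open>A decidable range makes it possible to search through a type by searching through all
  numbers and discarding those that code nothing.\<close>

class coded =
  fixes enc :: "'a \<Rightarrow> nat"
  assumes inj_enc: "inj enc"
    and range_enc: "\<exists>f. \<forall>n. reval f [n] = Some (of_bool (n \<in> range enc))"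

lemma enc_eq_iff [simp]: "enc x = enc y \<longleftrightarrow> x = y" for x y :: "'a::coded"
  using inj_enc by (auto dest: injD)

definition dec :: "nat \<Rightarrow> 'a::coded" where
  "dec n = (if n \<in> range (enc :: 'a \<Rightarrow> nat) then inv enc n else undefined)"

lemma dec_enc [simp]: "dec (enc x) = x"
  by (simp add: dec_def inv_f_f[OF inj_enc])

text \<open>The realizing term is constrained only on codes; on other numbers it may have any value
  or none.\<close>

definition computable :: "('a::coded \<Rightarrow> 'b::coded) \<Rightarrow> bool" where
  "computable f \<longleftrightarrow> (\<exists>g. \<forall>x. reval g [enc x] = Some (enc (f x)))"

lemma computableI: "(\<And>x. reval g [enc x] = Some (enc (f x))) \<Longrightarrow> computable f"
  by (auto simp: computable_def)

named_theorems comp_intros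

instantiation nat :: coded
begin
definition enc_nat :: "nat \<Rightarrow> nat" where [simp]: "enc_nat n = n"
instance proof
  show "\<exists>f. \<forall>n. reval f [n] = Some (of_bool (n \<in> range (enc :: nat \<Rightarrow> nat)))"
    by (rule exI[of _ "recf_const 1"]) (auto simp: image_def)
qed (auto intro: injI)
end

instantiation bool :: coded
begin
definition enc_bool :: "bool \<Rightarrow> nat" where [simp]: "enc_bool b = of_bool b"
instance proof
  show "\<exists>f. \<forall>n. reval f [n] = Some (of_bool (n \<in> range (enc :: bool \<Rightarrow> nat)))"
    by (rule exI[of _ "Comp recf_diff [recf_const 1, Comp recf_diff [Proj 0, recf_const 1]]"])
       (auto simp: image_def of_bool_def)
qed (auto intro!: injI simp: of_bool_def split: if_splits)
end

instantiation prod :: (coded, coded) coded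
begin
definition enc_prod :: "'a \<times> 'b \<Rightarrow> nat" where "enc_prod p = prod_encode (enc (fst p), enc (snd p))"
instance proof
  show "inj (enc :: 'a \<times> 'b \<Rightarrow> nat)"
    by (auto intro!: injI simp: enc_prod_def prod_encode_eq)
  obtain f g where f: "\<And>n. reval f [n] = Some (of_bool (n \<in> range (enc :: 'a \<Rightarrow> nat)))"
    and g: "\<And>n. reval g [n] = Some (of_bool (n \<in> range (enc :: 'b \<Rightarrow> nat)))"
    using range_enc by metis
  have *: "n \<in> range (enc :: 'a \<times> 'b \<Rightarrow> nat) \<longleftrightarrow>
      fst (prod_decode n) \<in> range (enc :: 'a \<Rightarrow> nat) \<and> snd (prod_decode n) \<in> range (enc :: 'b \<Rightarrow> nat)" for n
  proof
    assume "fst (prod_decode n) \<in> range (enc :: 'a \<Rightarrow> nat) \<and> snd (prod_decode n) \<in> range (enc :: 'b \<Rightarrow> nat)"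
    then obtain x y where "prod_decode n = (enc (x :: 'a), enc (y :: 'b))"
      by (metis prod.collapse image_iff)
    then have "n = enc (x, y)" by (metis enc_prod_def fst_conv snd_conv prod_decode_inverse)
    then show "n \<in> range (enc :: 'a \<times> 'b \<Rightarrow> nat)" by blast
  qed (auto simp: enc_prod_def)
  show "\<exists>f. \<forall>n. reval f [n] = Some (of_bool (n \<in> range (enc :: 'a \<times> 'b \<Rightarrow> nat)))"
    by (rule exI[of _ "Comp recf_pred [Comp recf_add [Comp f [recf_prod_fst], Comp g [recf_prod_snd]]]"])
       (simp add: f g * of_bool_def)
qed
end

lemma computable_id [comp_intros]: "computable (\<lambda>x. x)"
  by (rule computableI[of "Proj 0"]) simp

lemma computable_const [comp_intros]: "computable (\<lambda>x. c)"
  by (rule computableI[of "recf_const (enc c)"]) simp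

lemma computable_comp: "computable g \<Longrightarrow> computable f \<Longrightarrow> computable (\<lambda>x. g (f x))"
  unfolding computable_def
proof (elim exE)
  fix h k assume "\<forall>x. reval h [enc x] = Some (enc (g x))" "\<forall>x. reval k [enc x] = Some (enc (f x))"
  then show "\<exists>h. \<forall>x. reval h [enc x] = Some (enc (g (f x)))"
    by (intro exI[of _ "Comp h [k]"]) simp
qed

lemma computable_Pair [comp_intros]:
  "computable f \<Longrightarrow> computable g \<Longrightarrow> computable (\<lambda>x. (f x, g x))"
  unfolding computable_def
proof (elim exE)
  fix h k assume "\<forall>x. reval h [enc x] = Some (enc (f x))" "\<forall>x. reval k [enc x] = Some (enc (g x))"
  then show "\<exists>h. \<forall>x. reval h [enc x] = Some (enc (f x, g x))"
    by (intro exI[of _ "Comp recf_prod_encode [h, k]"]) (simp add: enc_prod_def)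
qed

lemma computable_comp2:
  assumes "computable (\<lambda>p. h (fst p) (snd p))" "computable f" "computable g"
  shows "computable (\<lambda>x. h (f x) (g x))"
  using computable_comp[OF assms(1) computable_Pair[OF assms(2,3)]] by simp

lemma computable_fst [comp_intros]: "computable f \<Longrightarrow> computable (\<lambda>x. fst (f x))"
  and computable_snd [comp_intros]: "computable f \<Longrightarrow> computable (\<lambda>x. snd (f x))"
  for f :: "'a::coded \<Rightarrow> 'b::coded \<times> 'c::coded"
proof -
  have "computable (fst :: 'b \<times> 'c \<Rightarrow> 'b)" "computable (snd :: 'b \<times> 'c \<Rightarrow> 'c)"
    by (rule computableI[of recf_prod_fst] computableI[of recf_prod_snd], simp add: enc_prod_def)+
  then show "computable f \<Longrightarrow> computable (\<lambda>x. fst (f x))" and "computable f \<Longrightarrow> computable (\<lambda>x. snd (f x))"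
    by (simp_all only: computable_comp[of fst f] computable_comp[of snd f])
qed

lemma computable_enc [comp_intros]: "computable f \<Longrightarrow> computable (\<lambda>x. enc (f x))"
  by (simp add: computable_def)

lemma computable_enc_cancel: "computable (\<lambda>x. enc (f x)) \<Longrightarrow> computable f"
  by (simp add: computable_def)

lemma computable_Suc [comp_intros]: "computable f \<Longrightarrow> computable (\<lambda>x. Suc (f x))"
  by (rule computable_comp[of Suc]) (auto intro: computableI[of Succ])

lemma computable_prod_encode [comp_intros]:
  "computable f \<Longrightarrow> computable (\<lambda>x. prod_encode (f x))"
  by (rule computable_comp[of prod_encode]) (auto intro!: computableI[of "Proj 0"] simp: enc_prod_def)

lemma computable_prod_decode [comp_intros]:
  "computable f \<Longrightarrow> computable (\<lambda>x. prod_decode (f x))"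
  by (rule computable_comp[of prod_decode]) (auto intro!: computableI[of "Proj 0"] simp: enc_prod_def)

lemma computable_plus [comp_intros]:
    "computable f \<Longrightarrow> computable g \<Longrightarrow> computable (\<lambda>x. f x + g x)"
  and computable_diff [comp_intros]:
    "computable f \<Longrightarrow> computable g \<Longrightarrow> computable (\<lambda>x. f x - g x)"
  for f g :: "'a::coded \<Rightarrow> nat"
proof -
  have "computable (\<lambda>p. fst p + snd p :: nat)"
    by (rule computableI[of "Comp recf_add [recf_prod_fst, recf_prod_snd]"]) (simp add: enc_prod_def)
  then show "computable f \<Longrightarrow> computable g \<Longrightarrow> computable (\<lambda>x. f x + g x)"
    by (rule computable_comp2)
  have "computable (\<lambda>p. fst p - snd p :: nat)"
    by (rule computableI[of "Comp recf_diff [recf_prod_fst, recf_prod_snd]"]) (simp add: enc_prod_def)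
  then show "computable f \<Longrightarrow> computable g \<Longrightarrow> computable (\<lambda>x. f x - g x)"
    by (rule computable_comp2)
qed

lemma computable_If [comp_intros]:
  assumes "computable P" "computable f" "computable g"
  shows "computable (\<lambda>x. if P x then f x else g x)"
proof -
  obtain p a b where p: "\<And>x. reval p [enc x] = Some (of_bool (P x))"
    and a: "\<And>x. reval a [enc x] = Some (enc (f x))" and b: "\<And>x. reval b [enc x] = Some (enc (g x))"
    using assms unfolding computable_def by (auto simp: enc_bool_def)
  \<comment> \<open>Recursion on a truth value is a case distinction: 0 evaluates \<open>b\<close>,
    and 1 evaluates \<open>a\<close> at \<open>Proj 2\<close>, where the original argument sits
    behind the counter and the recursive value.\<close>
  show ?thesis
    by (rule computableI[of "Comp (PrimRec b (Comp a [Proj 2])) [p, Proj 0]"]) (simp add: p a b)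
qed

text \<open>The only form of recursion used later on: multiplication, powers, bounded quantifiers
  and folds over lists are all obtained as iterations of a step function on a suitable
  state.\<close>

lemma computable_funpow [comp_intros]:
  fixes g :: "'a::coded \<Rightarrow> 'b::coded \<Rightarrow> 'b"
  assumes "computable (\<lambda>p. g (fst p) (snd p))" "computable n" "computable a"
  shows "computable (\<lambda>x. (g x ^^ n x) (a x))"
proof -
  obtain G N A where G: "\<And>p. reval G [enc p] = Some (enc (g (fst p) (snd p)))"
    and N: "\<And>x. reval N [enc x] = Some (n x)" and A: "\<And>x. reval A [enc x] = Some (enc (a x))"
    using assms unfolding computable_def enc_nat_def by blast
  have step: "reval G [prod_encode (enc x, enc y)] = Some (enc (g x y))" for x y
    using G[of "(x, y)"] by (simp add: enc_prod_def)
  have "reval (PrimRec A (Comp G [Comp recf_prod_encode [Proj 2, Proj 1]])) [k, enc x]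
      = Some (enc ((g x ^^ k) (a x)))" for k x
    by (induction k) (simp_all add: A step)
  then show ?thesis
    by (intro computableI[of "Comp (PrimRec A (Comp G [Comp recf_prod_encode [Proj 2, Proj 1]])) [N, Proj 0]"])
       (simp add: N del: reval.simps(5))
qed

lemma computable_eq_0: "computable f \<Longrightarrow> computable (\<lambda>x. f x = (0::nat))"
  by (rule computable_comp[of "\<lambda>n. n = 0"])
     (auto intro!: computableI[of "Comp recf_diff [recf_const 1, Proj 0]"] simp: of_bool_def)

lemma computable_le [comp_intros]:
  "computable f \<Longrightarrow> computable g \<Longrightarrow> computable (\<lambda>x. f x \<le> g x)" for f g :: "'a::coded \<Rightarrow> nat"
  using computable_eq_0[of "\<lambda>x. f x - g x"] by (simp add: computable_diff)

lemma computable_not [comp_intros]: "computable P \<Longrightarrow> computable (\<lambda>x. \<not> P x)"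
proof -
  assume "computable P"
  then have "computable (\<lambda>x. if P x then False else True)"
    by (intro computable_If computable_const)
  moreover have "(\<lambda>x. \<not> P x) = (\<lambda>x. if P x then False else True)" by auto
  ultimately show "computable (\<lambda>x. \<not> P x)" by (simp only:)
qed

lemma computable_conj [comp_intros]:
    "computable P \<Longrightarrow> computable Q \<Longrightarrow> computable (\<lambda>x. P x \<and> Q x)"
  and computable_disj [comp_intros]:
    "computable P \<Longrightarrow> computable Q \<Longrightarrow> computable (\<lambda>x. P x \<or> Q x)"
  and computable_imp [comp_intros]:
    "computable P \<Longrightarrow> computable Q \<Longrightarrow> computable (\<lambda>x. P x \<longrightarrow> Q x)"
proof -
  assume *: "computable P" "computable Q"
  have "(\<lambda>x. P x \<and> Q x) = (\<lambda>x. if P x then Q x else False)"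
    and "(\<lambda>x. P x \<or> Q x) = (\<lambda>x. if P x then True else Q x)"
    and "(\<lambda>x. P x \<longrightarrow> Q x) = (\<lambda>x. if P x then Q x else True)"
    by auto
  then show "computable (\<lambda>x. P x \<and> Q x)" "computable (\<lambda>x. P x \<or> Q x)" "computable (\<lambda>x. P x \<longrightarrow> Q x)"
    by (simp_all only: *) (intro computable_If computable_const *)+
qed

lemma computable_less [comp_intros]:
  "computable f \<Longrightarrow> computable g \<Longrightarrow> computable (\<lambda>x. f x < g x)" for f g :: "'a::coded \<Rightarrow> nat"
  using computable_not[OF computable_le[of g f]] by (simp add: not_le)

lemma computable_eq [comp_intros]:
  fixes f g :: "'a::coded \<Rightarrow> 'b::coded"
  assumes "computable f" "computable g"
  shows "computable (\<lambda>x. f x = g x)"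
proof -
  have "computable (\<lambda>x. enc (f x) \<le> enc (g x) \<and> enc (g x) \<le> enc (f x))"
    by (intro comp_intros assms)
  then show ?thesis by (simp flip: order_eq_iff)
qed

lemma computable_times [comp_intros]:
  fixes f g :: "'a::coded \<Rightarrow> nat"
  assumes "computable f" "computable g"
  shows "computable (\<lambda>x. f x * g x)"
proof -
  have "((+) b ^^ n) 0 = n * b" for b n :: nat by (induction n) auto
  moreover have "computable (\<lambda>x. ((+) (g x) ^^ f x) 0)"
    by (intro comp_intros assms computable_comp[of g fst])
  ultimately show ?thesis by simp
qed

lemma computable_all_less [comp_intros]:
  fixes P :: "'a::coded \<Rightarrow> nat \<Rightarrow> bool"
  assumes "computable (\<lambda>p. P (fst p) (snd p))" "computable n"
  shows "computable (\<lambda>x. \<forall>i<n x. P x i)"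
proof -
  let ?step = "\<lambda>x s. (Suc (fst s), snd s \<and> P x (fst s))"
  have *: "(?step x ^^ k) (0, True) = (k, \<forall>i<k. P x i)" for k x
    by (induction k) (auto simp: less_Suc_eq)
  have "computable (\<lambda>x. snd ((?step x ^^ n x) (0, True)))"
    by (intro comp_intros assms(2) computable_comp[OF assms(1), of "\<lambda>y. (fst y, fst (snd y))", simplified])
  then show ?thesis by (simp add: *)
qed

lemma computable_ex_less [comp_intros]:
  fixes P :: "'a::coded \<Rightarrow> nat \<Rightarrow> bool"
  assumes "computable (\<lambda>p. P (fst p) (snd p))" "computable n"
  shows "computable (\<lambda>x. \<exists>i<n x. P x i)"
  using computable_not[OF computable_all_less[OF computable_not[OF assms(1)] assms(2)]] by simp

lemma computable_dec [comp_intros]: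
  assumes "computable f"
  shows "computable (\<lambda>x. dec (f x) :: 'b::coded)"
proof (rule computable_comp[OF _ assms], rule computable_enc_cancel)
  obtain g where g: "\<And>n. reval g [n] = Some (of_bool (n \<in> range (enc :: 'b \<Rightarrow> nat)))"
    using range_enc by metis
  have "computable (\<lambda>n. n \<in> range (enc :: 'b \<Rightarrow> nat))"
    by (rule computableI[of g]) (simp add: g)
  then have "computable (\<lambda>n. if n \<in> range (enc :: 'b \<Rightarrow> nat) then n else enc (undefined :: 'b))"
    by (intro comp_intros)
  moreover have "(if n \<in> range (enc :: 'b \<Rightarrow> nat) then n else enc (undefined :: 'b)) = enc (dec n :: 'b)" for n
    by (auto simp: dec_def f_inv_into_f)
  ultimately show "computable (\<lambda>n. enc (dec n :: 'b))" by simp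
qed

lemma computable_Least:
  fixes P :: "'a::coded \<Rightarrow> nat \<Rightarrow> bool"
  assumes "computable (\<lambda>p. P (fst p) (snd p))" "\<And>x. \<exists>n. P x n"
  shows "computable (\<lambda>x. LEAST n. P x n)"
proof -
  \<comment> \<open>\<open>Mu\<close> searches for a zero, and truth is coded by 1, so the search
    runs on the negation.\<close>
  have "computable (\<lambda>p. \<not> P (fst p) (snd p))" by (intro comp_intros assms)
  then obtain p where p: "\<And>x n. reval p [enc (x, n)] = Some (of_bool (\<not> P x n))"
    unfolding computable_def by (auto simp: enc_bool_def)
  show ?thesis
  proof (rule computableI)
    fix x
    have "reval (Mu (Comp p [Comp recf_prod_encode [Proj 1, Proj 0]])) [enc x] = Some (LEAST n. (of_bool (\<not> P x n) :: nat) = 0)"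
      using p[of x] by (intro reval_Mu_total) (use assms(2) in \<open>auto simp: enc_prod_def\<close>)
    then show "reval (Mu (Comp p [Comp recf_prod_encode [Proj 1, Proj 0]])) [enc x] = Some (enc (LEAST n. P x n))"
      by (simp del: reval.simps)
  qed
qed

text \<open>The value is found by searching through all codes. This avoids having to compute normal
  forms, such as reduced fractions: it is enough to recognize the correct result.\<close>

lemma computable_of_graph:
  fixes f :: "'a::coded \<Rightarrow> 'b::coded"
  assumes "computable (\<lambda>p. f (fst p) = snd p)"
  shows "computable f"
proof -
  let ?P = "\<lambda>x n. enc (dec n :: 'b) = n \<and> f x = dec n"
  have "(LEAST n. ?P x n) = enc (f x)" for x
    by (rule Least_equality) auto
  then have "f x = dec (LEAST n. ?P x n)" for x by simp
  moreover have "computable (\<lambda>p. f (fst p) = dec (snd p))"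
    by (rule computable_comp2[OF assms]) (intro comp_intros)+
  then have "computable (\<lambda>p. ?P (fst p) (snd p))"
    by (intro computable_conj) (intro comp_intros)
  then have "computable (\<lambda>x. dec (LEAST n. ?P x n) :: 'b)"
    by (intro computable_dec computable_Least) (assumption, metis dec_enc)
  ultimately show ?thesis by presburger
qed

section \<open>Lists, integers and rationals\<close>

lemma computable_in_range: "computable (\<lambda>n. n \<in> range (enc :: 'a::coded \<Rightarrow> nat))"
  using range_enc[where 'a = 'a] by (auto simp: computable_def)

lemma range_encI:
  assumes "computable P" "\<And>n. n \<in> range e \<longleftrightarrow> P n"
  shows "\<exists>f. \<forall>n. reval f [n] = Some (of_bool (n \<in> range e))"
  using assms by (simp add: computable_def)

lemma length_le_list_encode: "length xs \<le> list_encode xs"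
  by (induction xs) (auto intro: order_trans[OF _ le_prod_encode_2])

instantiation list :: (coded) coded
begin
definition enc_list :: "'a list \<Rightarrow> nat" where "enc_list xs = list_encode (map enc xs)"
instance proof
  show "inj (enc :: 'a list \<Rightarrow> nat)"
    by (auto intro!: injI simp: enc_list_def list_encode_eq inj_map_eq_map[OF inj_enc])
  let ?R = "\<lambda>n. n \<in> range (enc :: 'a \<Rightarrow> nat)"
  \<comment> \<open>Each step removes one head from a coded list and records whether it is a
    legitimate code. The empty list is fixed by the step, so any number of steps that is at least
    the length will do, in particular the code itself.\<close>
  let ?step = "\<lambda>s. if fst s = 0 then s else
      (snd (prod_decode (fst s - 1)), snd s \<and> ?R (fst (prod_decode (fst s - 1))))"
  have *: "length xs \<le> k \<Longrightarrow> (?step ^^ k) (list_encode xs, b) = (0, b \<and> (\<forall>x\<in>set xs. ?R x))" for k xs b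
  proof (induction k arbitrary: xs b)
    case (Suc k)
    then show ?case
      using Suc.IH[of "[]" b] by (cases xs) (simp_all del: funpow.simps(2) add: funpow_Suc_right)
  qed simp
  show "\<exists>f. \<forall>n. reval f [n] = Some (of_bool (n \<in> range (enc :: 'a list \<Rightarrow> nat)))"
  proof (rule range_encI)
    show "computable (\<lambda>n. snd ((?step ^^ n) (n, True)))"
      by (intro comp_intros computable_comp[OF computable_in_range])
    fix n
    have "snd ((?step ^^ n) (n, True)) \<longleftrightarrow> (\<forall>x\<in>set (list_decode n). ?R x)"
      using *[of "list_decode n" n True] length_le_list_encode[of "list_decode n"] by simp
    also have "\<dots> \<longleftrightarrow> (\<exists>xs. list_decode n = map enc (xs :: 'a list))"
      by (simp add: ex_map_conv image_iff)
    also have "\<dots> \<longleftrightarrow> n \<in> range (enc :: 'a list \<Rightarrow> nat)"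
      unfolding enc_list_def image_iff by (metis UNIV_I list_decode_inverse list_encode_inverse)
    finally show "n \<in> range (enc :: 'a list \<Rightarrow> nat) \<longleftrightarrow> snd ((?step ^^ n) (n, True))" by blast
  qed
qed
end

lemma length_le_enc: "length xs \<le> enc xs"
  using length_le_list_encode[of "map enc xs"] by (simp add: enc_list_def)

lemma enc_Nil [simp]: "enc [] = 0"
  and enc_Cons: "enc (x # xs) = Suc (prod_encode (enc x, enc xs))"
  by (simp_all add: enc_list_def)

lemma computable_Cons [comp_intros]:
  "computable f \<Longrightarrow> computable g \<Longrightarrow> computable (\<lambda>x. f x # g x)"
  by (rule computable_enc_cancel) (simp add: enc_Cons, intro comp_intros)

text \<open>The empty list has code 0 and other lists have successors as codes, so a primitive
  recursion that ignores its recursive value distinguishes the cases. The list is passed a second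
  time as a parameter, from which head and tail are decoded.\<close>

lemma computable_case_list:
  assumes "computable l" "computable a" "computable (\<lambda>p. c (fst p) (fst (snd p)) (snd (snd p)))"
  shows "computable (\<lambda>x. case l x of [] \<Rightarrow> a x | y # ys \<Rightarrow> c x y ys)"
proof -
  obtain L A C where L: "\<And>x. reval L [enc x] = Some (enc (l x))"
    and A: "\<And>x. reval A [enc x] = Some (enc (a x))"
    and C: "\<And>p. reval C [enc p] = Some (enc (c (fst p) (fst (snd p)) (snd (snd p))))"
    using assms unfolding computable_def by blast
  let ?h = "Comp recf_prod_fst [Comp recf_pred [Proj 3]]"
  let ?t = "Comp recf_prod_snd [Comp recf_pred [Proj 3]]"
  let ?c = "Comp C [Comp recf_prod_encode [Proj 2, Comp recf_prod_encode [?h, ?t]]]"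
  have C': "reval C [prod_encode (enc x, prod_encode (enc y, enc ys))] = Some (enc (c x y ys))" for x y ys
    using C[of "(x, y, ys)"] by (simp add: enc_prod_def)
  have "reval (PrimRec (Comp A [Proj 0]) ?c) [k, enc x, enc (y # ys)]
      = Some (if k = 0 then enc (a x) else enc (c x y ys))" for k x y ys
    by (induction k) (simp_all add: A C' enc_Cons)
  from this[of "enc (_ # _)"] have *: "reval (PrimRec (Comp A [Proj 0]) ?c) [enc (y # ys), enc x, enc (y # ys)]
      = Some (enc (c x y ys))" for x y ys
    by (simp add: enc_Cons del: reval.simps)
  show ?thesis
  proof (rule computableI)
    fix x
    show "reval (Comp (PrimRec (Comp A [Proj 0]) ?c) [L, Proj 0, L]) [enc x]
        = Some (enc (case l x of [] \<Rightarrow> a x | y # ys \<Rightarrow> c x y ys))"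
    proof (cases "l x")
      case (Cons y ys)
      then show ?thesis using *[of y ys x] by (simp add: L del: reval.simps(5))
    qed (simp add: L A)
  qed
qed

lemma computable_fold [comp_intros]:
  fixes l :: "'a::coded \<Rightarrow> 'b::coded list" and a :: "'a \<Rightarrow> 'c::coded"
  assumes "computable (\<lambda>p. g (fst p) (fst (snd p)) (snd (snd p)))" "computable l" "computable a"
  shows "computable (\<lambda>x. fold (g x) (l x) (a x))"
proof -
  define step where "step x s = (case fst s of [] \<Rightarrow> s | y # ys \<Rightarrow> (ys, g x y (snd s)))" for x and s :: "'b list \<times> 'c"
  have *: "length xs \<le> k \<Longrightarrow> (step x ^^ k) (xs, s) = ([], fold (g x) xs s)" for k xs s x
  proof (induction k arbitrary: xs s)
    case (Suc k)
    then show ?case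
      using Suc.IH[of "[]" s] by (cases xs) (simp_all add: step_def del: funpow.simps(2) add: funpow_Suc_right)
  qed simp
  have "computable (\<lambda>p. step (fst p) (snd p))"
    unfolding step_def
    by (intro computable_case_list comp_intros
      computable_comp[OF assms(1), of "\<lambda>q. (fst (fst q), fst (snd q), snd (snd (fst q)))", simplified])
  then have "computable (\<lambda>x. snd ((step x ^^ enc (l x)) (l x, a x)))"
    by (intro comp_intros assms)
  then show ?thesis by (simp add: * length_le_enc)
qed

lemma computable_rev [comp_intros]: "computable l \<Longrightarrow> computable (\<lambda>x. rev (l x))"
proof -
  assume "computable l"
  moreover have "rev xs = fold Cons xs []" for xs :: "'b list" by (simp add: fold_Cons_rev)
  ultimately show ?thesis by (simp only:) (intro comp_intros)
qed

lemma computable_foldr [comp_intros]: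
  assumes "computable (\<lambda>p. g (fst p) (fst (snd p)) (snd (snd p)))" "computable l" "computable a"
  shows "computable (\<lambda>x. foldr (g x) (l x) (a x))"
  using assms by (simp only: foldr_conv_fold) (intro computable_fold comp_intros)

lemma computable_length [comp_intros]:
  assumes "computable l"
  shows "computable (\<lambda>x. length (l x))"
proof -
  have "length xs = foldr (\<lambda>_. Suc) xs 0" for xs :: "'b list" by (induction xs) auto
  then show ?thesis by (simp only:) (intro comp_intros assms)
qed

lemma computable_append [comp_intros]:
  assumes "computable l" "computable m"
  shows "computable (\<lambda>x. l x @ m x)"
proof -
  have "xs @ ys = foldr Cons xs ys" for xs ys :: "'b list" by (induction xs) auto
  then show ?thesis using assms by (simp only:) (intro comp_intros)
qed

lemma computable_map [comp_intros]:
  assumes "computable (\<lambda>p. g (fst p) (snd p))" "computable l"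
  shows "computable (\<lambda>x. map (g x) (l x))"
proof -
  have "computable (\<lambda>x. foldr (\<lambda>y ys. g x y # ys) (l x) [])"
    by (intro comp_intros assms computable_comp2[OF assms(1)])
  moreover have "foldr (\<lambda>y ys. h y # ys) xs [] = map h xs" for h :: "'b \<Rightarrow> 'c" and xs
    by (induction xs) auto
  ultimately show ?thesis by simp
qed

lemma computable_concat [comp_intros]:
  assumes "computable l"
  shows "computable (\<lambda>x. concat (l x))"
  unfolding concat_conv_foldr by (intro comp_intros assms)

lemma computable_subseqs [comp_intros]:
  fixes l :: "'a::coded \<Rightarrow> 'b::coded list"
  assumes "computable l"
  shows "computable (\<lambda>x. List.subseqs (l x))"
proof -
  have "List.subseqs xs = foldr (\<lambda>x xss. map ((#) x) xss @ xss) xs [[]]" for xs :: "'b list"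
    by (induction xs) (auto simp: Let_def)
  then show ?thesis by (simp only:) (intro comp_intros assms)
qed

lemma computable_suffixes [comp_intros]:
  assumes "computable l"
  shows "computable (\<lambda>x. suffixes (l x))"
proof -
  have "(xs, suffixes xs) = foldr (\<lambda>x s. (x # fst s, snd s @ [x # fst s])) xs ([], [[]])" for xs :: "'b list"
    by (induction xs) (auto simp: prod_eq_iff)
  then have "suffixes xs = snd (foldr (\<lambda>x s. (x # fst s, snd s @ [x # fst s])) xs ([], [[]]))" for xs :: "'b list"
    by (metis snd_conv)
  then show ?thesis by (simp only:) (intro comp_intros assms)
qed

lemma computable_Ball_set [comp_intros]:
  assumes "computable (\<lambda>p. P (fst p) (snd p))" "computable l"
  shows "computable (\<lambda>x. \<forall>y\<in>set (l x). P x y)"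
proof -
  have "foldr (\<lambda>y b. Q y \<and> b) xs True \<longleftrightarrow> (\<forall>y\<in>set xs. Q y)" for xs :: "'b list" and Q
    by (induction xs) auto
  moreover have "computable (\<lambda>x. foldr (\<lambda>y b. P x y \<and> b) (l x) True)"
    by (intro comp_intros assms computable_comp2[OF assms(1)])
  ultimately show ?thesis by simp
qed

lemma computable_Bex_set [comp_intros]:
  assumes "computable (\<lambda>p. P (fst p) (snd p))" "computable l"
  shows "computable (\<lambda>x. \<exists>y\<in>set (l x). P x y)"
  using computable_not[OF computable_Ball_set[OF computable_not[OF assms(1)] assms(2)]] by simp

lemma computable_in_set [comp_intros]:
  assumes "computable f" "computable l"
  shows "computable (\<lambda>x. f x \<in> set (l x))"
proof -
  have "computable (\<lambda>x. \<exists>y\<in>set (l x). y = f x)"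
    by (intro comp_intros assms computable_comp[OF assms(1)])
  then show ?thesis by simp
qed

text \<open>Replaces the recursion in \<open>sorted_wrt\<close> by bounded quantifiers, to which the
  closure rules apply even when the relation depends on a parameter.\<close>

lemma sorted_wrt_suffixes:
  "sorted_wrt P xs \<longleftrightarrow> (\<forall>s\<in>set (suffixes xs). case s of [] \<Rightarrow> True | y # ys \<Rightarrow> \<forall>z\<in>set ys. P y z)"
  by (induction xs) auto

lemma computable_sorted_wrt [comp_intros]:
  assumes "computable (\<lambda>p. P (fst p) (fst (snd p)) (snd (snd p)))" "computable l"
  shows "computable (\<lambda>x. sorted_wrt (P x) (l x))"
  unfolding sorted_wrt_suffixes
  by (intro comp_intros computable_case_list assms(2)
    computable_comp[OF assms(1), of "\<lambda>q. (fst (fst (fst q)), fst (snd (fst q)), snd q)", simplified])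

lemma computable_distinct [comp_intros]:
  assumes "computable l"
  shows "computable (\<lambda>x. distinct (l x))"
proof -
  have "distinct xs = sorted_wrt (\<noteq>) xs" for xs :: "'b list" by (induction xs) auto
  then show ?thesis by (simp only:) (intro comp_intros assms)
qed

lemma computable_prefix [comp_intros]:
  assumes "computable f" "computable g"
  shows "computable (\<lambda>x. prefix (f x) (g x))"
proof -
  have "prefix xs ys \<longleftrightarrow> (\<exists>zs\<in>set (suffixes ys). ys = xs @ zs)" for xs ys :: "'b list"
    by (auto simp: prefix_def suffix_def)
  then show ?thesis by (simp only:) (intro comp_intros assms computable_comp[OF assms(1)] computable_comp[OF assms(2)])
qed

section \<open>Integers and rationals\<close>

instantiation int :: coded
begin
definition enc_int :: "int \<Rightarrow> nat" where "enc_int = int_encode"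
instance proof
  show "\<exists>f. \<forall>n. reval f [n] = Some (of_bool (n \<in> range (enc :: int \<Rightarrow> nat)))"
    by (rule range_encI[where P = "\<lambda>_. True"]) (auto simp: enc_int_def surj_int_encode intro: comp_intros)
qed (simp add: enc_int_def inj_int_encode)
end

lemma computable_nat_minus_nat:
  assumes "computable f" "computable g"
  shows "computable (\<lambda>x. int (f x) - int (g x))"
proof (rule computable_enc_cancel)
  have "enc (int m - int n) = (if n \<le> m then (m - n) + (m - n) else (n - m) + (n - m) - 1)" for m n
    by (auto simp: enc_int_def int_encode_def sum_encode_def nat_diff_distrib)
  then show "computable (\<lambda>x. enc (int (f x) - int (g x)))"
    by (simp only:) (intro comp_intros assms)
qed

lemma computable_nat_int [comp_intros]:
  assumes "computable f"
  shows "computable (\<lambda>x. nat (f x))"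
proof (rule computable_comp[OF computable_of_graph assms])
  \<comment> \<open>The graph mentions only differences of natural numbers, which are already known
    to be computable. For negative \<open>i\<close> the search bound is right because
    \<open>enc i\<close> is at least the absolute value of \<open>i\<close>.\<close>
  have "nat i = n \<longleftrightarrow> i = int n - int 0 \<or> (n = 0 \<and> (\<exists>m<Suc (enc i). i = int 0 - int m))" for i n
  proof -
    have "n = 0 \<and> i < 0 \<Longrightarrow> \<exists>m<Suc (enc i). i = int 0 - int m"
      by (intro exI[of _ "nat (- i)"]) (auto simp: enc_int_def int_encode_def sum_encode_def)
    then show ?thesis by (cases "i < 0") auto
  qed
  then show "computable (\<lambda>p. nat (fst p) = snd p)"
    by (simp only:) (intro comp_intros computable_nat_minus_nat)
qed

lemma computable_uminus_int [comp_intros]: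
  fixes f :: "'a::coded \<Rightarrow> int"
  assumes "computable f"
  shows "computable (\<lambda>x. - f x)"
proof (rule computable_comp[OF computable_of_graph assms])
  have "- i = j \<longleftrightarrow> j = int (nat j) - int 0 \<and> i = int 0 - int (nat j) \<or>
      i = int (nat i) - int 0 \<and> j = int 0 - int (nat i)" for i j
    by auto
  then show "computable (\<lambda>p. - fst p = (snd p :: int))"
    by (simp only:) (intro comp_intros computable_nat_minus_nat)
qed

lemma computable_plus_int [comp_intros]:
  fixes f g :: "'a::coded \<Rightarrow> int"
  assumes "computable f" "computable g"
  shows "computable (\<lambda>x. f x + g x)"
proof -
  have "i + j = int (nat i + nat j) - int (nat (- i) + nat (- j))" for i j by auto
  then show ?thesis by (simp only:) (intro computable_nat_minus_nat comp_intros assms)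
qed

lemma computable_times_int [comp_intros]:
  fixes f g :: "'a::coded \<Rightarrow> int"
  assumes "computable f" "computable g"
  shows "computable (\<lambda>x. f x * g x)"
proof -
  have "i * j = int (nat i * nat j + nat (- i) * nat (- j)) - int (nat i * nat (- j) + nat (- i) * nat j)" for i j
    by (cases "0 \<le> i"; cases "0 \<le> j") auto
  then show ?thesis by (simp only:) (intro computable_nat_minus_nat comp_intros assms)
qed

lemma computable_less_int [comp_intros]:
  fixes f g :: "'a::coded \<Rightarrow> int"
  assumes "computable f" "computable g"
  shows "computable (\<lambda>x. f x < g x)"
proof -
  have "i < j \<longleftrightarrow> 0 < nat (j + - i)" for i j :: int by auto
  then show ?thesis by (simp only:) (intro comp_intros assms)
qed

text \<open>Recognizes the reduced fractions among all pairs, by a bounded search for a common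
  divisor; this is what decides the range of the coding of rationals.\<close>

lemma computable_coprime_pos:
  "computable (\<lambda>p :: int \<times> int. 0 < snd p \<and> coprime (fst p) (snd p))"
proof -
  have nat_dvd: "m dvd n \<longleftrightarrow> (\<exists>k<Suc n. n = m * k)" if "m \<noteq> 0" for m n :: nat
  proof
    assume "m dvd n"
    then obtain k where "n = m * k" by (rule dvdE)
    then show "\<exists>k<Suc n. n = m * k" using that by (intro exI[of _ k]) (simp add: less_Suc_eq_le)
  qed auto
  have "0 < b \<and> coprime a b \<longleftrightarrow> 0 < b \<and> (\<forall>d<Suc (nat b). d = 0 \<or> d = 1 \<or>
      \<not> ((\<exists>k<Suc (nat a + nat (- a)). nat a + nat (- a) = d * k) \<and> (\<exists>k<Suc (nat b). nat b = d * k)))" for a b :: int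
  proof (cases "0 < b")
    case True
    have abs: "nat a + nat (- a) = nat \<bar>a\<bar>" by auto
    have "coprime a b \<longleftrightarrow> coprime (nat \<bar>a\<bar>) (nat b)"
      using True by (simp add: coprime_int_iff[symmetric])
    also have "\<dots> \<longleftrightarrow> (\<forall>d. d dvd nat \<bar>a\<bar> \<and> d dvd nat b \<longrightarrow> d = 1)"
      unfolding coprime_def by (simp add: imp_conjL)
    also have "\<dots> \<longleftrightarrow> (\<forall>d<Suc (nat b). d = 0 \<or> d = 1 \<or> \<not> (d dvd nat \<bar>a\<bar> \<and> d dvd nat b))"
    proof -
      have "d dvd nat b \<Longrightarrow> d < Suc (nat b) \<and> d \<noteq> 0" for d
        using True dvd_imp_le[of d "nat b"] by (cases "d = 0") (simp_all add: less_Suc_eq_le)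
      then show ?thesis by blast
    qed
    also have "\<dots> \<longleftrightarrow> (\<forall>d<Suc (nat b). d = 0 \<or> d = 1 \<or>
        \<not> ((\<exists>k<Suc (nat \<bar>a\<bar>). nat \<bar>a\<bar> = d * k) \<and> (\<exists>k<Suc (nat b). nat b = d * k)))"
      by (intro all_cong disj_cong refl) (subst nat_dvd, assumption, subst nat_dvd, assumption, rule refl)
    finally show ?thesis unfolding abs using True by simp
  qed simp
  then show ?thesis by (simp only:) (intro comp_intros)
qed

instantiation rat :: coded
begin
definition enc_rat :: "rat \<Rightarrow> nat" where "enc_rat q = enc (quotient_of q)"
instance proof
  show "inj (enc :: rat \<Rightarrow> nat)"
    by (auto intro!: injI simp: enc_rat_def quotient_of_inject_eq)
  show "\<exists>f. \<forall>n. reval f [n] = Some (of_bool (n \<in> range (enc :: rat \<Rightarrow> nat)))"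
  proof (rule range_encI)
    let ?Q = "\<lambda>p :: int \<times> int. 0 < snd p \<and> coprime (fst p) (snd p)"
    show "computable (\<lambda>n. n \<in> range (enc :: int \<times> int \<Rightarrow> nat) \<and> ?Q (dec n))"
      by (intro computable_conj computable_in_range computable_comp[OF computable_coprime_pos] comp_intros)
    have Q: "?Q p \<longleftrightarrow> p \<in> range quotient_of" for p
    proof
      assume "?Q p"
      then have "quotient_of (Fract (fst p) (snd p)) = p"
        by (cases p) (simp add: quotient_of_Fract normalize_stable)
      then show "p \<in> range quotient_of" by (metis rangeI)
    next
      assume "p \<in> range quotient_of"
      then obtain q where "quotient_of q = (fst p, snd p)" by auto
      then show "?Q p" using quotient_of_denom_pos quotient_of_coprime by blast
    qed
    fix n
    show "n \<in> range (enc :: rat \<Rightarrow> nat) \<longleftrightarrow> n \<in> range (enc :: int \<times> int \<Rightarrow> nat) \<and> ?Q (dec n)"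
    proof
      assume "n \<in> range (enc :: rat \<Rightarrow> nat)"
      then obtain q where "n = enc (quotient_of q)" by (auto simp: enc_rat_def)
      then show "n \<in> range (enc :: int \<times> int \<Rightarrow> nat) \<and> ?Q (dec n)" by (simp add: Q)
    next
      assume "n \<in> range (enc :: int \<times> int \<Rightarrow> nat) \<and> ?Q (dec n)"
      then obtain p :: "int \<times> int" and q where "n = enc p" "p = quotient_of q" unfolding Q by auto
      then show "n \<in> range (enc :: rat \<Rightarrow> nat)" by (metis enc_rat_def rangeI)
    qed
  qed
qed
end

lemma computable_quotient_of [comp_intros]: "computable f \<Longrightarrow> computable (\<lambda>x. quotient_of (f x))"
  by (rule computable_enc_cancel) (simp add: enc_rat_def[symmetric] computable_enc)

lemma rat_eq_quotient:
  obtains "r = of_int (fst (quotient_of r)) / of_int (snd (quotient_of r))"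
    "(0 :: rat) < of_int (snd (quotient_of r))"
  using that quotient_of_div[of r] by (simp add: quotient_of_denom_pos')

lemma computable_less_rat [comp_intros]:
  fixes f g :: "'a::coded \<Rightarrow> rat"
  assumes "computable f" "computable g"
  shows "computable (\<lambda>x. f x < g x)"
proof -
  have "p < q \<longleftrightarrow> fst (quotient_of p) * snd (quotient_of q) < fst (quotient_of q) * snd (quotient_of p)" for p q
  proof -
    obtain a b c d where "p = of_int a / of_int b" "q = of_int c / of_int d" "(0 :: rat) < of_int b" "(0 :: rat) < of_int d"
      and abcd: "quotient_of p = (a, b)" "quotient_of q = (c, d)"
      by (metis rat_eq_quotient prod.collapse)
    then have "p < q \<longleftrightarrow> rat_of_int a * of_int d < of_int c * of_int b"
      by (simp add: divide_less_eq less_divide_eq)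
    then show ?thesis by (simp add: abcd flip: of_int_mult)
  qed
  then show ?thesis by (simp only:) (intro comp_intros assms)
qed

lemma computable_plus_rat [comp_intros]:
    "computable f \<Longrightarrow> computable g \<Longrightarrow> computable (\<lambda>x. f x + g x)"
  and computable_times_rat [comp_intros]:
    "computable f \<Longrightarrow> computable g \<Longrightarrow> computable (\<lambda>x. f x * g x)"
  for f g :: "'a::coded \<Rightarrow> rat"
proof -
  \<comment> \<open>Clearing denominators makes the graphs of addition and multiplication polynomial
    identities over the integers, so no greatest common divisor is computed.\<close>
  have *: "p + q = r \<longleftrightarrow>
      (fst (quotient_of p) * snd (quotient_of q) + fst (quotient_of q) * snd (quotient_of p)) * snd (quotient_of r)
      = fst (quotient_of r) * (snd (quotient_of p) * snd (quotient_of q))" (is ?add)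
    "p * q = r \<longleftrightarrow> fst (quotient_of p) * fst (quotient_of q) * snd (quotient_of r)
      = fst (quotient_of r) * (snd (quotient_of p) * snd (quotient_of q))" (is ?mult) for p q r
  proof -
    obtain a b c d e f where "p = of_int a / of_int b" "q = of_int c / of_int d" "r = of_int e / of_int f"
      "(0 :: rat) < of_int b" "(0 :: rat) < of_int d" "(0 :: rat) < of_int f"
      and abcdef: "quotient_of p = (a, b)" "quotient_of q = (c, d)" "quotient_of r = (e, f)"
      by (metis rat_eq_quotient prod.collapse)
    then have "p + q = r \<longleftrightarrow> (rat_of_int a * of_int d + of_int c * of_int b) * of_int f = of_int e * (of_int b * of_int d)"
      "p * q = r \<longleftrightarrow> rat_of_int a * of_int c * of_int f = of_int e * (of_int b * of_int d)"
      by (simp_all add: add_frac_eq frac_eq_eq)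
    then show ?add ?mult by (simp_all add: abcdef flip: of_int_mult of_int_add)
  qed
  have "computable (\<lambda>p. fst (fst p) + snd (fst p) = (snd p :: rat))"
    and "computable (\<lambda>p. fst (fst p) * snd (fst p) = (snd p :: rat))"
    unfolding * by (intro comp_intros)+
  then have arith: "computable (\<lambda>p. fst p + snd p :: rat)" "computable (\<lambda>p. fst p * snd p :: rat)"
    by (auto dest: computable_of_graph)
  show "computable f \<Longrightarrow> computable g \<Longrightarrow> computable (\<lambda>x. f x + g x)"
    and "computable f \<Longrightarrow> computable g \<Longrightarrow> computable (\<lambda>x. f x * g x)"
    by (rule computable_comp2, rule arith, assumption, assumption)+
qed

lemma computable_power_rat [comp_intros]:
  fixes f :: "'a::coded \<Rightarrow> rat"
  assumes "computable f" "computable n"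
  shows "computable (\<lambda>x. f x ^ n x)"
proof -
  have "q ^ k = ((*) q ^^ k) 1" for q :: rat and k by (induction k) auto
  then show ?thesis by (simp only:) (intro comp_intros assms computable_comp[OF assms(1)])
qed

lemma computable_sum_list_rat [comp_intros]:
  fixes l :: "'a::coded \<Rightarrow> rat list"
  assumes "computable l"
  shows "computable (\<lambda>x. sum_list (l x))"
  unfolding sum_list.eq_foldr by (intro comp_intros assms)

section \<open>Semidecidable predicates and a universal one\<close>

definition semidecidable :: "('a::coded \<Rightarrow> bool) \<Rightarrow> bool" where
  "semidecidable P \<longleftrightarrow> (\<exists>R. computable (\<lambda>p. R (fst p) (snd p)) \<and> (\<forall>x. P x \<longleftrightarrow> (\<exists>n::nat. R x n)))"

named_theorems semi_intros

lemma semidecidableE: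
  assumes "semidecidable P"
  obtains R where "computable (\<lambda>p. R (fst p) (snd p))" "\<And>x. P x \<longleftrightarrow> (\<exists>n::nat. R x n)"
  using assms unfolding semidecidable_def by blast

lemma semidecidableI:
  fixes R :: "'a::coded \<Rightarrow> nat \<Rightarrow> bool"
  assumes "computable (\<lambda>p. R (fst p) (snd p))" "\<And>x. P x \<longleftrightarrow> (\<exists>n. R x n)"
  shows "semidecidable P"
  using assms unfolding semidecidable_def by blast

lemma semidecidable_computable: "computable P \<Longrightarrow> semidecidable P"
  by (rule semidecidableI[of "\<lambda>x _. P x"]) (simp_all add: computable_comp[of P fst] computable_fst computable_id)

lemma semidecidable_comp:
  assumes "semidecidable P" "computable f"
  shows "semidecidable (\<lambda>x. P (f x))"
proof -
  obtain R where R: "computable (\<lambda>p. R (fst p) (snd p))" "\<And>x. P x \<longleftrightarrow> (\<exists>n::nat. R x n)"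
    using assms(1) by (rule semidecidableE) blast
  show ?thesis
    by (rule semidecidableI[of "\<lambda>x. R (f x)"])
       (intro computable_comp2[OF R(1)] comp_intros computable_comp[OF assms(2)], rule R(2))
qed

text \<open>A single number codes both a witness and the stage at which it is confirmed. Running
  over numbers instead of elements is harmless because \<open>dec\<close> is onto.\<close>

lemma semidecidable_ex [semi_intros]:
  fixes P :: "'a::coded \<Rightarrow> 'b::coded \<Rightarrow> bool"
  assumes "semidecidable (\<lambda>p. P (fst p) (snd p))"
  shows "semidecidable (\<lambda>x. \<exists>y. P x y)"
proof -
  obtain R where R: "computable (\<lambda>p. R (fst p) (snd p))" "\<And>p. P (fst p) (snd p) \<longleftrightarrow> (\<exists>n::nat. R p n)"
    using assms by (rule semidecidableE) blast
  show ?thesis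
  proof (rule semidecidableI)
    show "computable (\<lambda>p. R (fst p, dec (fst (prod_decode (snd p)))) (snd (prod_decode (snd p))))"
      by (intro computable_comp2[OF R(1)] comp_intros)
    fix x
    have "(\<exists>n. R (x, dec (fst (prod_decode n))) (snd (prod_decode n))) \<longleftrightarrow> (\<exists>a b. R (x, dec a) b)"
      by (metis fst_conv snd_conv prod_encode_inverse)
    also have "\<dots> \<longleftrightarrow> (\<exists>a. P x (dec a))" by (simp flip: R(2))
    also have "\<dots> \<longleftrightarrow> (\<exists>y. P x y)" by (metis dec_enc)
    finally show "(\<exists>y. P x y) \<longleftrightarrow> (\<exists>n. R (x, dec (fst (prod_decode n))) (snd (prod_decode n)))" ..
  qed
qed

lemma semidecidable_ex_nat:
  assumes "computable (\<lambda>p. R (fst p) (snd p))"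
  shows "semidecidable (\<lambda>x. \<exists>y. R x y)"
  by (intro semidecidable_ex semidecidable_computable assms)

lemma semidecidable_conj [semi_intros]:
    "semidecidable P \<Longrightarrow> semidecidable Q \<Longrightarrow> semidecidable (\<lambda>x. P x \<and> Q x)"
  and semidecidable_disj [semi_intros]:
    "semidecidable P \<Longrightarrow> semidecidable Q \<Longrightarrow> semidecidable (\<lambda>x. P x \<or> Q x)"
proof -
  assume "semidecidable P" "semidecidable Q"
  then obtain R S where R: "computable (\<lambda>p. R (fst p) (snd p))" "\<And>x. P x \<longleftrightarrow> (\<exists>n::nat. R x n)"
    and S: "computable (\<lambda>p. S (fst p) (snd p))" "\<And>x. Q x \<longleftrightarrow> (\<exists>n::nat. S x n)"
    by (elim semidecidableE) blast
  have "semidecidable (\<lambda>x. \<exists>m n. R x m \<and> S x n)" "semidecidable (\<lambda>x. \<exists>n. R x n \<or> S x n)"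
    by (intro semi_intros semidecidable_computable comp_intros computable_comp2[OF R(1)] computable_comp2[OF S(1)])+
  then show "semidecidable (\<lambda>x. P x \<and> Q x)" "semidecidable (\<lambda>x. P x \<or> Q x)"
    by (simp_all add: R(2) S(2) ex_disj_distrib)
qed

text \<open>Moves an unbounded search in front of a finite quantifier, which is why semidecidable
  predicates are closed under finite universal quantification.\<close>

lemma finite_ball_ex_bound:
  assumes "finite A"
  shows "(\<forall>a\<in>A. \<exists>n::nat. R a n) \<longleftrightarrow> (\<exists>b. \<forall>a\<in>A. \<exists>n<b. R a n)"
proof
  assume "\<forall>a\<in>A. \<exists>n. R a n"
  then obtain h where "\<forall>a\<in>A. R a (h a)" by metis
  then have "\<forall>a\<in>A. \<exists>n<Suc (Max (h ` A)). R a n"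
    using assms by (auto intro!: exI[of _ "h _"] simp: less_Suc_eq_le)
  then show "\<exists>b. \<forall>a\<in>A. \<exists>n<b. R a n" by blast
qed blast

lemma semidecidable_Ball_set [semi_intros]:
  fixes l :: "'a::coded \<Rightarrow> 'b::coded list"
  assumes "semidecidable (\<lambda>p. P (fst p) (snd p))" "computable l"
  shows "semidecidable (\<lambda>x. \<forall>y\<in>set (l x). P x y)"
proof -
  obtain R where R: "computable (\<lambda>p. R (fst p) (snd p))" "\<And>p. P (fst p) (snd p) \<longleftrightarrow> (\<exists>n::nat. R p n)"
    using assms(1) by (rule semidecidableE) blast
  have "semidecidable (\<lambda>x. \<exists>b. \<forall>y\<in>set (l x). \<exists>n<b. R (x, y) n)"
    by (intro semidecidable_ex_nat comp_intros computable_comp2[OF R(1)] computable_comp[OF assms(2)])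
  moreover have "(\<forall>y\<in>set (l x). P x y) \<longleftrightarrow> (\<exists>b. \<forall>y\<in>set (l x). \<exists>n<b. R (x, y) n)" for x
    by (subst finite_ball_ex_bound[symmetric]) (simp_all flip: R(2))
  ultimately show ?thesis by simp
qed

lemma semidecidable_all_less [semi_intros]:
  fixes m :: "'a::coded \<Rightarrow> nat"
  assumes "semidecidable (\<lambda>p. P (fst p) (snd p))" "computable m"
  shows "semidecidable (\<lambda>x. \<forall>i<m x. P x i)"
proof -
  obtain R where R: "computable (\<lambda>p. R (fst p) (snd p))" "\<And>p. P (fst p) (snd p) \<longleftrightarrow> (\<exists>n::nat. R p n)"
    using assms(1) by (rule semidecidableE) blast
  have "semidecidable (\<lambda>x. \<exists>b. \<forall>i<m x. \<exists>n<b. R (x, i) n)"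
    by (intro semidecidable_ex_nat comp_intros computable_comp2[OF R(1)] computable_comp[OF assms(2)])
  moreover have "(\<forall>i<m x. P x i) \<longleftrightarrow> (\<exists>b. \<forall>i<m x. \<exists>n<b. R (x, i) n)" for x
    using finite_ball_ex_bound[of "{..<m x}" "\<lambda>i. R (x, i)"] by (simp add: Ball_def flip: R(2))
  ultimately show ?thesis by simp
qed

lemma semidecidable_eq [semi_intros]:
    "computable f \<Longrightarrow> computable g \<Longrightarrow> semidecidable (\<lambda>x. f x = g x)"
  and semidecidable_in_set [semi_intros]:
    "computable f \<Longrightarrow> computable l \<Longrightarrow> semidecidable (\<lambda>x. f x \<in> set (l x))"
  by (intro semidecidable_computable comp_intros; assumption)+

text \<open>The set is the domain of a search for a stage. Testing for legitimate codes inside the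
  search makes it diverge on all other numbers.\<close>

lemma ce_of_semidecidable:
  fixes P :: "'a::coded \<Rightarrow> bool"
  assumes "semidecidable P"
  shows "ce (enc ` Collect P)"
proof -
  obtain R where R: "computable (\<lambda>p. R (fst p) (snd p))" "\<And>x. P x \<longleftrightarrow> (\<exists>n::nat. R x n)"
    using assms by (rule semidecidableE) blast
  let ?Q = "\<lambda>k n. k \<in> range (enc :: 'a \<Rightarrow> nat) \<and> R (dec k) n"
  have "computable (\<lambda>p. \<not> ?Q (fst p) (snd p))"
    by (intro computable_not computable_conj computable_comp[OF computable_in_range] computable_comp2[OF R(1)] comp_intros)
  then obtain f where f: "\<And>k n. reval f [enc (k, n)] = Some (of_bool (\<not> ?Q k n))"
    unfolding computable_def by auto
  let ?f = "Comp f [Comp recf_prod_encode [Proj 1, Proj 0]]"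
  have f': "reval ?f [n, k] = Some (of_bool (\<not> ?Q k n))" for k n
    using f[of k n] by (simp add: enc_prod_def)
  have "reval (Mu ?f) [k] \<noteq> None \<longleftrightarrow> (\<exists>n. ?Q k n)" for k
  proof
    assume "\<exists>n. ?Q k n"
    then have "\<exists>n. (of_bool (\<not> ?Q k n) :: nat) = 0" by auto
    from reval_Mu_total[of ?f "[k]", OF f' this] show "reval (Mu ?f) [k] \<noteq> None" by (simp del: reval.simps)
  next
    assume "reval (Mu ?f) [k] \<noteq> None"
    then have "\<exists>n. reval ?f (n # [k]) = Some 0"
      by (subst (asm) reval.simps) (auto simp del: reval.simps split: if_splits)
    then show "\<exists>n. ?Q k n" unfolding f' by (auto simp: of_bool_def split: if_splits)
  qed
  moreover have "k \<in> enc ` Collect P \<longleftrightarrow> (\<exists>n. ?Q k n)" for k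
    by (auto simp: R(2) image_iff)
  ultimately have "enc ` Collect P = {k. reval (Mu ?f) [k] \<noteq> None}"
    by (intro set_eqI) (simp only: mem_Collect_eq)
  then show ?thesis unfolding ce_def by blast
qed

section \<open>A universal semidecidable predicate by means of derivations\<close>

fun code_recf :: "recf \<Rightarrow> nat" where
  "code_recf Zero = prod_encode (0, 0)"
| "code_recf Succ = prod_encode (1, 0)"
| "code_recf (Proj i) = prod_encode (2, i)"
| "code_recf (Comp f gs) = prod_encode (3, prod_encode (code_recf f, enc (map code_recf gs)))"
| "code_recf (PrimRec f g) = prod_encode (4, prod_encode (code_recf f, code_recf g))"
| "code_recf (Mu f) = prod_encode (5, code_recf f)"

type_synonym derivation = "(nat \<times> nat list \<times> nat) list"

text \<open>A triple \<open>(e, xs, y)\<close> asserts that the function coded by \<open>e\<close> has value \<open>y\<close> at \<open>xs\<close>; a derivation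
  lists such triples, the latest first, each following from later entries of the list.\<close>

definition justified :: "derivation \<Rightarrow> nat \<Rightarrow> nat list \<Rightarrow> nat \<Rightarrow> bool" where
  "justified D e xs y \<longleftrightarrow>
     e = prod_encode (0, 0) \<and> y = 0 \<or>
     e = prod_encode (1, 0) \<and> (\<exists>x. xs = [x] \<and> y = Suc x) \<or>
     (\<exists>us vs. xs = us @ y # vs \<and> e = prod_encode (2, length us)) \<or>
     (\<exists>f ps. e = prod_encode (3, prod_encode (f, enc (map fst ps))) \<and>
        (\<forall>p\<in>set ps. (fst p, xs, snd p) \<in> set D) \<and> (f, map snd ps, y) \<in> set D) \<or>
     (\<exists>f g ys. e = prod_encode (4, prod_encode (f, g)) \<and> xs = 0 # ys \<and> (f, ys, y) \<in> set D) \<or>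
     (\<exists>f g m ys r. e = prod_encode (4, prod_encode (f, g)) \<and> xs = Suc m # ys \<and>
        (e, m # ys, r) \<in> set D \<and> (g, m # r # ys, y) \<in> set D) \<or>
     (\<exists>f. e = prod_encode (5, f) \<and> (f, y # xs, 0) \<in> set D \<and>
        (\<forall>m<y. \<exists>z. (f, m # xs, Suc z) \<in> set D))"

primrec valid :: "derivation \<Rightarrow> bool" where
  "valid [] \<longleftrightarrow> True"
| "valid (t # D) \<longleftrightarrow> justified D (fst t) (fst (snd t)) (snd (snd t)) \<and> valid D"

text \<open>A derivation is checked locally, entry by entry against its tail; in this form
  semidecidability follows from the closure rules alone, without an interpreter that counts
  steps.\<close>

lemma valid_suffixes:
  "valid D \<longleftrightarrow> (\<forall>s\<in>set (suffixes D). s = [] \<or>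
     (\<exists>t D'. s = t # D' \<and> justified D' (fst t) (fst (snd t)) (snd (snd t))))"
  by (induction D) auto

lemma semidecidable_valid: "semidecidable valid"
  unfolding valid_suffixes justified_def by (intro semi_intros comp_intros)

definition universal_pred :: "nat \<Rightarrow> nat \<Rightarrow> bool" where
  "universal_pred e n \<longleftrightarrow> (\<exists>D y. valid D \<and> (e, [n], y) \<in> set D)"

lemma semidecidable_universal_pred: "semidecidable (\<lambda>p. universal_pred (fst p) (snd p))"
  unfolding universal_pred_def by (intro semi_intros semidecidable_comp[OF semidecidable_valid] comp_intros)

lemma those_eq_Some:
  assumes "map fst ps = map code_recf gs" "\<And>g y. (code_recf g, y) \<in> set ps \<Longrightarrow> reval g xs = Some y"
  shows "those (map (\<lambda>g. reval g xs) gs) = Some (map snd ps)"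
  using assms
proof (induction gs arbitrary: ps)
  case (Cons g gs)
  then obtain y ps' where ps: "ps = (code_recf g, y) # ps'" "map fst ps' = map code_recf gs"
    by (cases ps) (auto simp: prod_eq_iff)
  have "those (map (\<lambda>g. reval g xs) gs) = Some (map snd ps')"
    by (rule Cons.IH) (use ps Cons.prems in auto)
  moreover have "reval g xs = Some y" by (rule Cons.prems(2)) (simp add: ps)
  ultimately show ?case by (simp add: ps)
qed simp

text \<open>An entry is justified by the tail behind it, so induction on the list supplies
  correctness of everything it refers to. The distinct tags in \<open>code_recf\<close> force the
  clause of \<open>justified\<close> that belongs to the outermost constructor.\<close>

lemma valid_sound: "valid D \<Longrightarrow> (code_recf f, xs, y) \<in> set D \<Longrightarrow> reval f xs = Some y"
proof (induction D arbitrary: f xs y)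
  case (Cons t D)
  note IH = Cons.IH[OF conjunct2[OF Cons.prems(1)[unfolded valid.simps]]]
  show ?case
  proof (cases "t = (code_recf f, xs, y)")
    case True
    then have just: "justified D (code_recf f) xs y" using Cons.prems(1) by simp
    show ?thesis
    proof (cases f)
      case (Comp h gs)
      with just obtain ps where ps: "map fst ps = map code_recf gs"
        "\<forall>p\<in>set ps. (fst p, xs, snd p) \<in> set D" "(code_recf h, map snd ps, y) \<in> set D"
        by (auto simp: justified_def prod_encode_eq)
      have "those (map (\<lambda>g. reval g xs) gs) = Some (map snd ps)"
        by (rule those_eq_Some[OF ps(1)]) (use ps(2) in \<open>auto intro!: IH\<close>)
      then show ?thesis using IH[OF ps(3)] by (simp add: Comp)
    next
      case (PrimRec h g)
      from just consider ys where "xs = 0 # ys" "(code_recf h, ys, y) \<in> set D"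
        | m ys r where "xs = Suc m # ys" "(code_recf f, m # ys, r) \<in> set D" "(code_recf g, m # r # ys, y) \<in> set D"
        by (auto simp: justified_def prod_encode_eq PrimRec)
      then show ?thesis
      proof cases
        case 1
        then show ?thesis using IH[OF 1(2)] by (simp add: PrimRec)
      next
        case 2
        then show ?thesis using IH[OF 2(2)] IH[OF 2(3)] by (simp add: PrimRec)
      qed
    next
      case (Mu h)
      with just have *: "(code_recf h, y # xs, 0) \<in> set D" "\<And>m. m < y \<Longrightarrow> \<exists>z. (code_recf h, m # xs, Suc z) \<in> set D"
        by (auto simp: justified_def prod_encode_eq)
      have "reval h (y # xs) = Some 0" using IH[OF *(1)] .
      moreover have less: "\<exists>z. reval h (m # xs) = Some (Suc z)" if "m < y" for m
        using *(2)[OF that] IH by blast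
      moreover have least: "(LEAST n. reval h (n # xs) = Some 0) = y"
      proof (rule Least_equality, rule IH[OF *(1)])
        fix n assume "reval h (n # xs) = Some 0"
        then show "y \<le> n" using less[of n] by (cases "n < y") auto
      qed
      ultimately have "\<exists>n. reval h (n # xs) = Some 0 \<and> (\<forall>m<n. \<exists>y>0. reval h (m # xs) = Some y)"
        by (metis zero_less_Suc)
      then show ?thesis by (simp add: Mu least)
    qed (use just in \<open>auto simp: justified_def prod_encode_eq\<close>)
  next
    case False
    then show ?thesis using Cons.prems(2) by (auto intro!: IH)
  qed
qed simp

lemma justified_mono: "justified D e xs y \<Longrightarrow> set D \<subseteq> set D' \<Longrightarrow> justified D' e xs y"
  unfolding justified_def by (elim disj_forward ex_forward conj_forward; blast)

text \<open>Appending \<open>D'\<close> only enlarges the tail available to each entry of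
  \<open>D\<close>, and justification is monotone in that tail. Finitely many derivations can thus
  be merged into one.\<close>

lemma valid_append: "valid D \<Longrightarrow> valid D' \<Longrightarrow> valid (D @ D')"
  by (induction D) (auto intro: justified_mono)

definition derivable :: "nat \<times> nat list \<times> nat \<Rightarrow> bool" where
  "derivable t \<longleftrightarrow> (\<exists>D. valid D \<and> t \<in> set D)"

lemma derivable_finite:
  assumes "finite S" "\<And>t. t \<in> S \<Longrightarrow> derivable t"
  obtains D where "valid D" "S \<subseteq> set D"
proof -
  from assms have "\<exists>D. valid D \<and> S \<subseteq> set D"
  proof (induction S)
    case (insert t S)
    then obtain D' where "valid D'" "S \<subseteq> set D'" by auto
    moreover obtain D where "valid D" "t \<in> set D"
      using insert.prems[of t] unfolding derivable_def by auto
    ultimately show ?case by (intro exI[of _ "D @ D'"]) (auto intro: valid_append)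
  qed (auto intro: exI[of _ "[]"])
  then show ?thesis using that by blast
qed

lemma derivableI: "valid D \<Longrightarrow> justified D e xs y \<Longrightarrow> derivable (e, xs, y)"
  unfolding derivable_def by (rule exI[of _ "(e, xs, y) # D"]) simp

text \<open>Structural induction on the term; the finitely many evaluations that one value depends
  on have derivations, which are merged and extended by one entry. Primitive recursion needs an
  inner induction on the recursion argument.\<close>

lemma derivable_complete: "reval f xs = Some y \<Longrightarrow> derivable (code_recf f, xs, y)"
proof (induction f arbitrary: xs y)
  case Zero
  then show ?case by (intro derivableI[of "[]"]) (auto simp: justified_def)
next
  case Succ
  then show ?case by (intro derivableI[of "[]"]) (auto simp: justified_def split: list.splits)
next
  case (Proj i)
  then have "i < length xs" "xs ! i = y" by (auto split: if_splits)
  then have "xs = take i xs @ y # drop (Suc i) xs" "length (take i xs) = i" by (auto simp: id_take_nth_drop)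
  then have "justified [] (code_recf (Proj i)) xs y"
    unfolding justified_def code_recf.simps by metis
  then show ?case by (intro derivableI[of "[]"]) simp_all
next
  case (Comp f gs)
  then obtain ys where ys: "those (map (\<lambda>g. reval g xs) gs) = Some ys" "reval f ys = Some y"
    by (auto simp: bind_eq_Some_conv)
  have map: "map (\<lambda>g. reval g xs) gs = map Some ys"
    using ys(1) by (induction gs arbitrary: ys) (auto split: option.splits)
  then have len: "length gs = length ys" by (metis length_map)
  let ?ps = "zip (map code_recf gs) ys"
  let ?S = "insert (code_recf f, ys, y) ((\<lambda>p. (fst p, xs, snd p)) ` set ?ps)"
  have derivable: "derivable t" if "t \<in> ?S" for t
    using that
  proof
    assume "t = (code_recf f, ys, y)"
    then show ?thesis using Comp.IH(1) ys(2) by simp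
  next
    assume "t \<in> (\<lambda>p. (fst p, xs, snd p)) ` set ?ps"
    then obtain i where i: "i < length gs" "t = (code_recf (gs ! i), xs, ys ! i)"
      by (auto simp: set_zip)
    moreover have "reval (gs ! i) xs = Some (ys ! i)"
      using arg_cong[OF map, of "\<lambda>l. l ! i"] i(1) len by simp
    ultimately show ?thesis using Comp.IH(2)[of "gs ! i"] by simp
  qed
  obtain D where "valid D" and D: "?S \<subseteq> set D"
    by (rule derivable_finite[of ?S]) (use derivable in blast)+
  have "code_recf (Comp f gs) = prod_encode (3, prod_encode (code_recf f, enc (map fst ?ps))) \<and>
      (\<forall>p\<in>set ?ps. (fst p, xs, snd p) \<in> set D) \<and> (code_recf f, map snd ?ps, y) \<in> set D"
    using D len by auto
  then have "justified D (code_recf (Comp f gs)) xs y" unfolding justified_def by blast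
  with \<open>valid D\<close> show ?case by (rule derivableI)
next
  case (PrimRec f g)
  then obtain n ys where xs: "xs = n # ys" by (cases xs) auto
  have "reval (PrimRec f g) (n # ys) = Some z \<Longrightarrow> derivable (code_recf (PrimRec f g), n # ys, z)" for n z
  proof (induction n arbitrary: z)
    case 0
    then have "derivable (code_recf f, ys, z)" by (intro PrimRec.IH) simp
    then obtain D where "valid D" "(code_recf f, ys, z) \<in> set D" unfolding derivable_def by blast
    then show ?case by (intro derivableI[of D]) (auto simp: justified_def)
  next
    case (Suc n)
    then obtain r where r: "reval (PrimRec f g) (n # ys) = Some r" "reval g (n # r # ys) = Some z"
      by (auto simp: bind_eq_Some_conv)
    obtain D where "valid D" "{(code_recf (PrimRec f g), n # ys, r), (code_recf g, n # r # ys, z)} \<subseteq> set D"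
      by (rule derivable_finite[of "{(code_recf (PrimRec f g), n # ys, r), (code_recf g, n # r # ys, z)}"])
         (use Suc.IH[OF r(1)] PrimRec.IH(2)[OF r(2)] in auto)
    then show ?case by (intro derivableI[of D]) (auto simp: justified_def)
  qed
  then show ?case using PrimRec.prems xs by blast
next
  case (Mu f)
  then obtain n where n: "reval f (n # xs) = Some 0" "\<forall>m<n. \<exists>z>0. reval f (m # xs) = Some z"
    and y: "y = (LEAST n. reval f (n # xs) = Some 0)"
    by (auto split: if_splits)
  have "y = n" unfolding y
  proof (rule Least_equality, rule n(1))
    fix m assume "reval f (m # xs) = Some 0"
    moreover have "\<exists>z>0. reval f (m # xs) = Some z" if "m < n" using n(2) that by blast
    ultimately show "n \<le> m" by (metis leI less_irrefl option.inject)
  qed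
  define h where "h m = the (reval f (m # xs)) - 1" for m
  have h: "reval f (m # xs) = Some (Suc (h m))" if m: "m < n" for m
  proof -
    obtain z where "z > 0" "reval f (m # xs) = Some z" using n(2) m by blast
    then show ?thesis by (simp add: h_def)
  qed
  let ?S = "insert (code_recf f, n # xs, 0) ((\<lambda>m. (code_recf f, m # xs, Suc (h m))) ` {..<n})"
  have derivable: "derivable t" if "t \<in> ?S" for t
    using that
  proof (elim insertE imageE)
    show "t = (code_recf f, n # xs, 0) \<Longrightarrow> ?thesis" using Mu.IH[OF n(1)] by simp
    show "derivable t" if "t = (code_recf f, m # xs, Suc (h m))" "m \<in> {..<n}" for m
      using Mu.IH[OF h[of m]] that by simp
  qed
  obtain D where "valid D" and D: "?S \<subseteq> set D"
    by (rule derivable_finite[of ?S]) (use derivable in blast)+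
  have "code_recf (Mu f) = prod_encode (5, code_recf f) \<and> (code_recf f, n # xs, 0) \<in> set D \<and>
      (\<forall>m<n. \<exists>z. (code_recf f, m # xs, Suc z) \<in> set D)"
    using D by auto
  then have "justified D (code_recf (Mu f)) xs y" unfolding justified_def \<open>y = n\<close> by blast
  with \<open>valid D\<close> show ?case by (rule derivableI)
qed

lemma ce_universal_pred:
  assumes "ce A"
  obtains e where "A = {n. universal_pred e n}"
proof -
  obtain f where A: "A = {n. reval f [n] \<noteq> None}" using assms unfolding ce_def by blast
  have "reval f [n] \<noteq> None \<longleftrightarrow> universal_pred (code_recf f) n" for n
    using derivable_complete[of f "[n]"] valid_sound[of _ f "[n]"]
    unfolding universal_pred_def derivable_def by (metis not_None_eq)
  then show ?thesis using that A by blast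
qed

section \<open>Measures with prescribed conditional probabilities\<close>

text \<open>Here \<open>x \<sigma>\<close> is the conditional probability that the next bit after
  \<open>\<sigma>\<close> is \<open>False\<close>, and the product is the chain rule.\<close>

definition cyl_prob :: "(bool list \<Rightarrow> real) \<Rightarrow> bool list \<Rightarrow> real" where
  "cyl_prob x \<sigma> = (\<Prod>i<length \<sigma>. if \<sigma> ! i then 1 - x (take i \<sigma>) else x (take i \<sigma>))"

definition unit_cube :: "('a \<Rightarrow> real) set" where
  "unit_cube = {x. \<forall>i. 0 \<le> x i \<and> x i \<le> 1}"

lemma cyl_prob_Nil [simp]: "cyl_prob x [] = 1"
  by (simp add: cyl_prob_def)

lemma cyl_prob_snoc [simp]: "cyl_prob x (\<sigma> @ [b]) = cyl_prob x \<sigma> * (if b then 1 - x \<sigma> else x \<sigma>)"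
proof -
  have "(\<Prod>i<length \<sigma>. if \<sigma> ! i then 1 - x (take i (\<sigma> @ [b])) else x (take i (\<sigma> @ [b]))) = cyl_prob x \<sigma>"
    unfolding cyl_prob_def by (rule prod.cong) auto
  then show ?thesis by (simp add: cyl_prob_def[of x "\<sigma> @ [b]"] nth_append)
qed

lemma cyl_prob_nonneg: "x \<in> unit_cube \<Longrightarrow> 0 \<le> cyl_prob x \<sigma>"
  by (auto simp: cyl_prob_def unit_cube_def intro!: prod_nonneg)

lemma continuous_on_cyl_prob: "continuous_on A (\<lambda>x. cyl_prob x \<sigma>)"
  unfolding cyl_prob_def
proof (rule continuous_on_prod)
  have proj: "continuous_on A (\<lambda>x :: bool list \<Rightarrow> real. x \<tau>)" for \<tau>
    by (rule continuous_on_product_then_coordinatewise[OF continuous_on_id])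
  show "continuous_on A (\<lambda>x. if \<sigma> ! i then 1 - x (take i \<sigma>) else x (take i \<sigma>))" for i
    by (cases "\<sigma> ! i") (simp_all add: continuous_on_diff proj)
qed

text \<open>The labelling \<open>u\<close> prescribes a next bit at every node of the tree;
  \<open>branch u n\<close> is the initial segment of length \<open>n\<close> of the path that obeys
  it.\<close>

primrec branch :: "(bool list \<Rightarrow> bool) \<Rightarrow> nat \<Rightarrow> bool list" where
  "branch u 0 = []"
| "branch u (Suc n) = branch u n @ [u (branch u n)]"

lemma branch_in_cylinder:
  "(\<lambda>n. u (branch u n)) \<in> cylinder \<sigma> \<longleftrightarrow> (\<forall>i<length \<sigma>. u (take i \<sigma>) = \<sigma> ! i)"
proof -
  have *: "branch u n = take n \<sigma>"
    if "n \<le> length \<sigma>" and u: "\<forall>i<length \<sigma>. u (branch u i) = \<sigma> ! i \<or> u (take i \<sigma>) = \<sigma> ! i" for n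
    using that(1)
  proof (induction n)
    case (Suc n)
    then have "branch u n = take n \<sigma>" "n < length \<sigma>" by auto
    moreover from this have "u (take n \<sigma>) = \<sigma> ! n" using u by metis
    ultimately show ?case by (simp add: take_Suc_conv_app_nth)
  qed simp
  show ?thesis
  proof
    assume "(\<lambda>n. u (branch u n)) \<in> cylinder \<sigma>"
    then have u: "\<forall>i<length \<sigma>. u (branch u i) = \<sigma> ! i" by (simp add: cylinder_def)
    then have "branch u i = take i \<sigma>" if "i < length \<sigma>" for i using *[of i] that by simp
    then show "\<forall>i<length \<sigma>. u (take i \<sigma>) = \<sigma> ! i" using u by simp
  next
    assume u: "\<forall>i<length \<sigma>. u (take i \<sigma>) = \<sigma> ! i"
    then have "branch u i = take i \<sigma>" if "i < length \<sigma>" for i using *[of i] that by simp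
    then show "(\<lambda>n. u (branch u n)) \<in> cylinder \<sigma>" using u by (simp add: cylinder_def)
  qed
qed

text \<open>Lets Borel measurability of maps into Cantor space be checked coordinatewise.\<close>

instance bool :: second_countable_topology
proof
  have "open = generate_topology (UNIV :: bool set set)"
    by (rule ext) (simp add: discrete_topology_class.open_discrete generate_topology.Basis)
  then show "\<exists>B :: bool set set. countable B \<and> open = generate_topology B"
    by (intro exI[of _ UNIV]) simp
qed

text \<open>Independent coins are tossed at all nodes of the tree, the one at
  \<open>\<sigma>\<close> showing \<open>True\<close> with probability
  \<open>1 - x \<sigma>\<close>. The law of the path that obeys them is the required measure,
  because reaching \<open>\<sigma>\<close> depends on the coins at its proper prefixes only.\<close>

lemma exists_measure_cyl_prob:
  assumes "x \<in> unit_cube"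
  obtains \<mu> where "borel_prob \<mu>" "\<And>\<sigma>. cyl_measure \<mu> \<sigma> = cyl_prob x \<sigma>"
proof
  define M where "M \<sigma> = measure_pmf (bernoulli_pmf (1 - x \<sigma>))" for \<sigma>
  interpret product_prob_space M UNIV
    by unfold_locales (auto simp: M_def measure_pmf.emeasure_space_1 intro: measure_pmf.sigma_finite_measure_axioms)
  let ?P = "Pi\<^sub>M UNIV M"
  let ?f = "\<lambda>u n. u (branch u n)"
  have pred: "Measurable.pred ?P (\<lambda>u. u \<sigma>)" for \<sigma>
  proof -
    have "(\<lambda>u. u \<sigma>) \<in> measurable ?P (M \<sigma>)" by (rule measurable_component_singleton) simp
    moreover have "sets (M \<sigma>) = sets (count_space UNIV)" by (simp add: M_def)
    ultimately show ?thesis using measurable_cong_sets[of ?P ?P "M \<sigma>" "count_space UNIV"] by blast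
  qed
  have "Measurable.pred ?P (\<lambda>u. ?f u n)" for n
  proof -
    \<comment> \<open>A countable disjunction of conditions on finitely many coins, hence a
      measurable event.\<close>
    have "?f u n \<longleftrightarrow> (\<exists>\<sigma>. length \<sigma> = Suc n \<and> \<sigma> ! n \<and> (\<forall>i<length \<sigma>. u (take i \<sigma>) = \<sigma> ! i))" for u
    proof
      assume "?f u n"
      moreover have "?f u \<in> cylinder (map (?f u) [0..<Suc n])" by (auto simp: cylinder_def simp del: upt_Suc)
      ultimately show "\<exists>\<sigma>. length \<sigma> = Suc n \<and> \<sigma> ! n \<and> (\<forall>i<length \<sigma>. u (take i \<sigma>) = \<sigma> ! i)"
        unfolding branch_in_cylinder by (intro exI[of _ "map (?f u) [0..<Suc n]"]) (simp del: upt_Suc)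
    next
      assume "\<exists>\<sigma>. length \<sigma> = Suc n \<and> \<sigma> ! n \<and> (\<forall>i<length \<sigma>. u (take i \<sigma>) = \<sigma> ! i)"
      then obtain \<sigma> where "length \<sigma> = Suc n" "\<sigma> ! n" "?f u \<in> cylinder \<sigma>" unfolding branch_in_cylinder by blast
      then show "?f u n" by (auto simp: cylinder_def)
    qed
    moreover have "Measurable.pred ?P (\<lambda>u. \<exists>\<sigma>. length \<sigma> = Suc n \<and> \<sigma> ! n \<and> (\<forall>i<length \<sigma>. u (take i \<sigma>) = \<sigma> ! i))"
    proof -
      note pred [measurable]
      show ?thesis by measurable
    qed
    ultimately show ?thesis by (simp only:)
  qed
  then have "(\<lambda>u. ?f u n) \<in> borel_measurable ?P" for n
    using measurable_cong_sets[OF refl sets_borel_eq_count_space, of ?P] by blast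
  then have meas: "?f \<in> borel_measurable ?P" by (rule measurable_coordinatewise_then_product)
  let ?\<mu> = "distr ?P borel ?f"
  show "borel_prob ?\<mu>"
    using meas by (simp add: borel_prob_def P.prob_space_distr)
  fix \<sigma>
  have measure_eq: "cyl_measure ?\<mu> \<sigma> = measure ?P {u \<in> space ?P. \<forall>i<length \<sigma>. u (take i \<sigma>) = \<sigma> ! i}"
    using meas by (subst measure_distr) (auto simp: cylinder_borel branch_in_cylinder[symmetric] intro!: arg_cong[of _ _ "measure _"])
  \<comment> \<open>The proper prefixes of \<open>\<sigma>\<close> have different lengths, so they
    are distinct nodes and the length of a prefix tells which bit is demanded there; independence
    then gives the product.\<close>
  have "{u \<in> space ?P. \<forall>i<length \<sigma>. u (take i \<sigma>) = \<sigma> ! i}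
      = {u \<in> space ?P. \<forall>\<tau>\<in>(\<lambda>i. take i \<sigma>) ` {..<length \<sigma>}. u \<tau> \<in> {\<sigma> ! length \<tau>}}"
    by auto
  moreover have "emeasure ?P \<dots> = (\<Prod>\<tau>\<in>(\<lambda>i. take i \<sigma>) ` {..<length \<sigma>}. emeasure (M \<tau>) {\<sigma> ! length \<tau>})"
    by (rule emeasure_PiM_Collect) (auto simp: M_def)
  moreover have "\<dots> = (\<Prod>i<length \<sigma>. emeasure (M (take i \<sigma>)) {\<sigma> ! i})"
    by (subst prod.reindex) (auto intro!: inj_onI prod.cong dest: arg_cong[of _ _ length])
  moreover have "\<dots> = (\<Prod>i<length \<sigma>. ennreal (if \<sigma> ! i then 1 - x (take i \<sigma>) else x (take i \<sigma>)))"
    using assms by (intro prod.cong refl) (auto simp: M_def emeasure_pmf_single unit_cube_def)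
  moreover have "\<dots> = ennreal (cyl_prob x \<sigma>)"
    unfolding cyl_prob_def using assms by (intro prod_ennreal) (auto simp: unit_cube_def)
  ultimately show "cyl_measure ?\<mu> \<sigma> = cyl_prob x \<sigma>"
    using cyl_prob_nonneg[OF assms] measure_eq by (simp only: measure_def enn2real_ennreal)
qed

section \<open>Extending a semimeasure to a measure\<close>

text \<open>Strings grow at their end while recursion consumes the front, so the string is reversed.
  The root gets 1 rather than \<open>s []\<close>, which also restores the mass missing at the
  root.\<close>

fun filling_rev :: "(bool list \<Rightarrow> real) \<Rightarrow> bool list \<Rightarrow> real" where
  "filling_rev s [] = 1"
| "filling_rev s (b # \<sigma>) = s (rev (b # \<sigma>)) +
     (filling_rev s \<sigma> - s (rev \<sigma> @ [False]) - s (rev \<sigma> @ [True])) / 2"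

text \<open>The mass lost by \<open>s\<close> at a node is distributed evenly among its two children.\<close>

definition filling :: "(bool list \<Rightarrow> real) \<Rightarrow> bool list \<Rightarrow> real" where
  "filling s \<sigma> = filling_rev s (rev \<sigma>)"

lemma filling_Nil [simp]: "filling s [] = 1"
  by (simp add: filling_def)

lemma filling_snoc: "filling s (\<sigma> @ [b]) = s (\<sigma> @ [b]) +
    (filling s \<sigma> - s (\<sigma> @ [False]) - s (\<sigma> @ [True])) / 2"
  by (simp add: filling_def)

lemma filling_additive: "filling s (\<sigma> @ [False]) + filling s (\<sigma> @ [True]) = filling s \<sigma>"
  by (simp add: filling_snoc field_simps)

text \<open>If the parent has at least its share under \<open>s\<close>, then superadditivity of
  \<open>s\<close> makes the amount split between the children nonnegative.\<close>

lemma filling_ge: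
  assumes "semimeasure s"
  shows "s \<sigma> \<le> filling s \<sigma>"
proof (induction \<sigma> rule: rev_induct)
  case (snoc b \<sigma>)
  then show ?case
    using assms unfolding semimeasure_def filling_snoc by (smt (verit) divide_nonneg_nonneg)
qed (use assms in \<open>auto simp: semimeasure_def\<close>)

lemma filling_nonneg: "semimeasure s \<Longrightarrow> 0 \<le> filling s \<sigma>"
  by (rule order_trans[OF _ filling_ge]) (simp_all add: semimeasure_def)

lemma continuous_on_filling:
  assumes "\<And>\<sigma>. continuous_on A (\<lambda>x. s x \<sigma>)"
  shows "continuous_on A (\<lambda>x. filling (s x) \<sigma>)"
  by (induction \<sigma> rule: rev_induct) (auto simp: filling_snoc intro!: continuous_intros assms)

lemma exists_measure_ge:
  assumes "semimeasure s"
  obtains \<mu> where "borel_prob \<mu>" "\<And>\<sigma>. s \<sigma> \<le> cyl_measure \<mu> \<sigma>"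
proof -
  let ?c = "filling s"
  \<comment> \<open>At a node without mass the quotient is 0 by convention; this is harmless since
    the children of such a node have no mass either.\<close>
  let ?x = "\<lambda>\<sigma>. ?c (\<sigma> @ [False]) / ?c \<sigma>"
  have nonneg: "0 \<le> ?c \<sigma>" for \<sigma> using filling_nonneg[OF assms] .
  have "?c (\<sigma> @ [False]) \<le> ?c \<sigma>" for \<sigma>
    using filling_additive[of s \<sigma>] nonneg[of "\<sigma> @ [True]"] by linarith
  then have "?x \<in> unit_cube"
    using nonneg by (auto simp: unit_cube_def divide_le_eq_1 less_le)
  then obtain \<mu> where \<mu>: "borel_prob \<mu>" "\<And>\<sigma>. cyl_measure \<mu> \<sigma> = cyl_prob ?x \<sigma>"
    by (rule exists_measure_cyl_prob) blast
  have "cyl_prob ?x \<sigma> = ?c \<sigma>" for \<sigma>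
  proof (induction \<sigma> rule: rev_induct)
    case (snoc b \<sigma>)
    show ?case
    proof (cases "?c \<sigma> = 0")
      case True
      then have "?c (\<sigma> @ [b]) = 0"
        using filling_additive[of s \<sigma>] nonneg[of "\<sigma> @ [True]"] nonneg[of "\<sigma> @ [False]"] by (cases b) auto
      then show ?thesis by (simp add: snoc True)
    next
      case False
      moreover have "?c (\<sigma> @ [True]) = ?c \<sigma> - ?c (\<sigma> @ [False])"
        using filling_additive[of s \<sigma>] by linarith
      ultimately show ?thesis by (cases b) (simp_all add: snoc right_diff_distrib)
    qed
  qed simp
  then show ?thesis using that[OF \<mu>(1)] filling_ge[OF assms] by (simp add: \<mu>(2))
qed

section \<open>The Poincare-Miranda theorem on a countable cube\<close>

lemma compact_unit_cube: "compact (unit_cube :: ('a \<Rightarrow> real) set)"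
proof -
  have "(unit_cube :: ('a \<Rightarrow> real) set) = Pi\<^sub>E UNIV (\<lambda>_. {0..1})"
    by (auto simp: unit_cube_def)
  moreover have "compactin (product_topology (\<lambda>_. euclidean) UNIV) (Pi\<^sub>E (UNIV :: 'a set) (\<lambda>_. {0..1::real}))"
    by (simp add: compactin_PiE)
  ultimately show ?thesis by (simp add: euclidean_product_topology)
qed

lemma tendsto_fun_iff: "(f \<longlongrightarrow> l) F \<longleftrightarrow> (\<forall>i. ((\<lambda>c. f c i) \<longlongrightarrow> l i) F)"
  for f :: "'b \<Rightarrow> 'a \<Rightarrow> real"
  using limitin_componentwise[of "\<lambda>_. euclidean" UNIV f l F]
  by (simp add: euclidean_product_topology)

text \<open>Kuhn's combinatorial lemma on a grid in which \<open>N\<close> is both the number of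
  active coordinates and the number of subdivisions; coordinates beyond the first \<open>N\<close>
  are set to 0. A single small cell contains, for every active coordinate, points with either
  sign.\<close>

lemma miranda_approx:
  fixes g :: "('a::countable \<Rightarrow> real) \<Rightarrow> 'a \<Rightarrow> real"
  assumes "\<And>x i. x \<in> unit_cube \<Longrightarrow> x i = 0 \<Longrightarrow> 0 \<le> g x i"
    and "\<And>x i. x \<in> unit_cube \<Longrightarrow> x i = 1 \<Longrightarrow> g x i \<le> 0"
    and "0 < N"
  obtains c where "c \<in> unit_cube"
    "\<And>i. to_nat i < N \<Longrightarrow> \<exists>y\<in>unit_cube. (\<forall>j. \<bar>y j - c j\<bar> \<le> 1 / N) \<and> 0 \<le> g y i"
    "\<And>i. to_nat i < N \<Longrightarrow> \<exists>z\<in>unit_cube. (\<forall>j. \<bar>z j - c j\<bar> \<le> 1 / N) \<and> g z i \<le> 0"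
proof -
  define emb :: "(nat \<Rightarrow> nat) \<Rightarrow> 'a \<Rightarrow> real"
    where "emb r i = (if to_nat i < N then min 1 (r (to_nat i) / N) else 0)" for r i
  \<comment> \<open>Label 0 stands for a nonnegative and label 1 for a nonpositive value. Kuhn's
    lemma prescribes the labels on opposite faces, and there the boundary hypotheses guarantee the
    sign that the label claims.\<close>
  define label :: "(nat \<Rightarrow> nat) \<Rightarrow> nat \<Rightarrow> nat"
    where "label r j = (if r j \<noteq> N \<and> (r j = 0 \<or> 0 \<le> g (emb r) (from_nat j)) then 0 else 1)" for r j
  have emb: "emb r \<in> unit_cube" for r by (auto simp: unit_cube_def emb_def)
  obtain q where q: "\<forall>i<N. q i < N"
    "\<forall>i<N. \<exists>r s. (\<forall>j<N. q j \<le> r j \<and> r j \<le> q j + 1) \<and> (\<forall>j<N. q j \<le> s j \<and> s j \<le> q j + 1) \<and> label r i \<noteq> label s i"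
    by (rule kuhn_lemma[of N N label]) (use \<open>0 < N\<close> in \<open>auto simp: label_def\<close>)
  have close: "\<bar>emb r j - emb q j\<bar> \<le> 1 / N" if "\<forall>j<N. q j \<le> r j \<and> r j \<le> q j + 1" for r j
  proof (cases "to_nat j < N")
    case True
    then have "q (to_nat j) \<le> r (to_nat j)" "r (to_nat j) \<le> q (to_nat j) + 1" using that by auto
    then have "real (q (to_nat j)) / N \<le> r (to_nat j) / N" "r (to_nat j) / N \<le> q (to_nat j) / N + 1 / N"
      by (simp_all add: divide_right_mono flip: add_divide_distrib)
    then show ?thesis by (simp add: emb_def True)
  qed (simp add: emb_def)
  have label0: "0 \<le> g (emb r) i" if "label r (to_nat i) = 0" for r i
    using that assms(1)[OF emb, of r i] by (auto simp: label_def emb_def split: if_splits)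
  have label1: "g (emb r) i \<le> 0" if "label r (to_nat i) \<noteq> 0" "to_nat i < N" for r i
    using that assms(2)[OF emb, of r i] \<open>0 < N\<close> by (auto simp: label_def emb_def split: if_splits)
  show ?thesis
  proof (rule that[of "emb q"])
    fix i :: 'a assume i: "to_nat i < N"
    then obtain r s where "\<forall>j<N. q j \<le> r j \<and> r j \<le> q j + 1" "\<forall>j<N. q j \<le> s j \<and> s j \<le> q j + 1"
      "label r (to_nat i) \<noteq> label s (to_nat i)"
      using q(2) by blast
    then have "\<exists>r s. (\<forall>j<N. q j \<le> r j \<and> r j \<le> q j + 1) \<and> (\<forall>j<N. q j \<le> s j \<and> s j \<le> q j + 1) \<and>
        label r (to_nat i) = 0 \<and> label s (to_nat i) \<noteq> 0"
      by (metis label_def)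
    then show "\<exists>y\<in>unit_cube. (\<forall>j. \<bar>y j - emb q j\<bar> \<le> 1 / N) \<and> 0 \<le> g y i"
      "\<exists>z\<in>unit_cube. (\<forall>j. \<bar>z j - emb q j\<bar> \<le> 1 / N) \<and> g z i \<le> 0"
      using close label0 label1[OF _ i] emb by meson+
  qed (rule emb)
qed

lemma tendsto_of_close:
  fixes c y :: "nat \<Rightarrow> 'a \<Rightarrow> real"
  assumes "c \<longlonglongrightarrow> x" "\<And>n j. \<bar>y n j - c n j\<bar> \<le> e n" "e \<longlonglongrightarrow> 0"
  shows "y \<longlonglongrightarrow> x"
  unfolding tendsto_fun_iff
proof
  fix j
  have "(\<lambda>n. y n j - c n j) \<longlonglongrightarrow> 0"
    by (rule Lim_null_comparison[OF _ assms(3)]) (use assms(2) in auto)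
  moreover have "(\<lambda>n. c n j) \<longlonglongrightarrow> x j" using assms(1) unfolding tendsto_fun_iff by blast
  ultimately show "(\<lambda>n. y n j) \<longlonglongrightarrow> x j" using tendsto_add by fastforce
qed

text \<open>The approximate zeros accumulate at some \<open>x\<close> by compactness. Each fixed
  coordinate is active from some index on, so \<open>x\<close> is a limit of points with either sign
  and continuity leaves only the value 0.\<close>

theorem poincare_miranda_cube:
  fixes g :: "('a::countable \<Rightarrow> real) \<Rightarrow> 'a \<Rightarrow> real"
  assumes "\<And>i. continuous_on unit_cube (\<lambda>x. g x i)"
    and "\<And>x i. x \<in> unit_cube \<Longrightarrow> x i = 0 \<Longrightarrow> 0 \<le> g x i"
    and "\<And>x i. x \<in> unit_cube \<Longrightarrow> x i = 1 \<Longrightarrow> g x i \<le> 0"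
  obtains x where "x \<in> unit_cube" "\<And>i. g x i = 0"
proof -
  define near where "near c n y \<longleftrightarrow> y \<in> unit_cube \<and> (\<forall>j. \<bar>y j - c j\<bar> \<le> 1 / Suc n)"
    for c y :: "'a \<Rightarrow> real" and n
  have "\<exists>c\<in>unit_cube. \<forall>i. to_nat i < Suc n \<longrightarrow>
      (\<exists>y. near c n y \<and> 0 \<le> g y i) \<and> (\<exists>z. near c n z \<and> g z i \<le> 0)" for n
  proof -
    obtain c where "c \<in> unit_cube"
      "\<And>i. to_nat i < Suc n \<Longrightarrow> \<exists>y\<in>unit_cube. (\<forall>j. \<bar>y j - c j\<bar> \<le> 1 / real (Suc n)) \<and> 0 \<le> g y i"
      "\<And>i. to_nat i < Suc n \<Longrightarrow> \<exists>z\<in>unit_cube. (\<forall>j. \<bar>z j - c j\<bar> \<le> 1 / real (Suc n)) \<and> g z i \<le> 0"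
      by (rule miranda_approx[of g "Suc n"]) (use assms(2,3) in blast)+
    then show ?thesis unfolding near_def by (intro bexI[of _ c]) (blast, assumption)
  qed
  then obtain c where c: "\<And>n. c n \<in> unit_cube"
    and near: "\<And>n i. to_nat i < Suc n \<Longrightarrow> (\<exists>y. near (c n) n y \<and> 0 \<le> g y i) \<and> (\<exists>z. near (c n) n z \<and> g z i \<le> 0)"
    by metis
  obtain x r where x: "x \<in> unit_cube" and r: "strict_mono r" and lim: "(c \<circ> r) \<longlonglongrightarrow> x"
    using compact_imp_seq_compact[OF compact_unit_cube] c unfolding seq_compact_def by metis
  have "g x i = 0" for i
  proof -
    \<comment> \<open>While coordinate \<open>i\<close> is still inactive, \<open>c n\<close> itself
      serves as a filler, so that sequences defined for all \<open>n\<close> can be chosen.\<close>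
    have "\<exists>y. near (c n) n y \<and> (to_nat i < Suc n \<longrightarrow> 0 \<le> g y i)"
      "\<exists>z. near (c n) n z \<and> (to_nat i < Suc n \<longrightarrow> g z i \<le> 0)" for n
    proof -
      have "near (c n) n (c n)" using c[of n] by (simp add: near_def)
      then show "\<exists>y. near (c n) n y \<and> (to_nat i < Suc n \<longrightarrow> 0 \<le> g y i)"
        "\<exists>z. near (c n) n z \<and> (to_nat i < Suc n \<longrightarrow> g z i \<le> 0)"
        using near[of i n] by blast+
    qed
    then obtain y z where y: "\<And>n. near (c n) n (y n)" "\<And>n. to_nat i < Suc n \<Longrightarrow> 0 \<le> g (y n) i"
      and z: "\<And>n. near (c n) n (z n)" "\<And>n. to_nat i < Suc n \<Longrightarrow> g (z n) i \<le> 0"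
      by metis
    have e: "(\<lambda>n. 1 / real (Suc (r n))) \<longlonglongrightarrow> 0"
      using LIMSEQ_subseq_LIMSEQ[OF LIMSEQ_inverse_real_of_nat r] by (simp add: o_def inverse_eq_divide)
    have "(\<lambda>n. y (r n)) \<longlonglongrightarrow> x" "(\<lambda>n. z (r n)) \<longlonglongrightarrow> x"
      by (rule tendsto_of_close[OF lim _ e]; use y(1) z(1) in \<open>auto simp: near_def\<close>)+
    moreover have "(\<lambda>n. g (w n) i) \<longlonglongrightarrow> g x i" if "w \<longlonglongrightarrow> x" "\<And>n. w n \<in> unit_cube" for w
      using assms(1)[of i] x that unfolding continuous_on_sequentially o_def by blast
    ultimately have gy: "(\<lambda>n. g (y (r n)) i) \<longlonglongrightarrow> g x i" and gz: "(\<lambda>n. g (z (r n)) i) \<longlonglongrightarrow> g x i"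
      using y(1) z(1) by (simp_all add: near_def)
    have ev: "\<forall>n\<ge>to_nat i. to_nat i < Suc (r n)"
      using seq_suble[OF r] by (meson le_imp_less_Suc order_trans)
    show ?thesis
    proof (rule antisym)
      show "g x i \<le> 0" by (rule LIMSEQ_le_const2[OF gz]) (use ev z(2) in blast)
      show "0 \<le> g x i" by (rule LIMSEQ_le_const[OF gy]) (use ev y(2) in blast)
    qed
  qed
  then show ?thesis using that x by blast
qed

section \<open>Fixed points of lower semicontinuous semimeasure-valued maps\<close>

locale lsc_semimeasures =
  fixes \<phi> :: "(bool list \<Rightarrow> real) \<Rightarrow> bool list \<Rightarrow> real"
  assumes semimeasure: "x \<in> unit_cube \<Longrightarrow> semimeasure (\<phi> x)"
    and lsc: "x \<in> unit_cube \<Longrightarrow> a < \<phi> x \<sigma> \<Longrightarrow> \<exists>\<delta>>0. \<forall>y\<in>unit_cube. dist x y < \<delta> \<longrightarrow> a < \<phi> y \<sigma>"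
begin

text \<open>The weight \<open>1 / 2 ^ length \<sigma>\<close> of the penalty makes the regularization superadditive in \<open>\<sigma>\<close>.\<close>

definition reg :: "nat \<Rightarrow> (bool list \<Rightarrow> real) \<Rightarrow> bool list \<Rightarrow> real" where
  "reg k x \<sigma> = (INF y\<in>unit_cube. \<phi> y \<sigma> + k / 2 ^ length \<sigma> * dist x y)"

lemma unit_cube_nonempty: "(unit_cube :: (bool list \<Rightarrow> real) set) \<noteq> {}"
  by (auto simp: unit_cube_def intro!: exI[of _ "\<lambda>_. 0"])

lemma nonneg: "x \<in> unit_cube \<Longrightarrow> 0 \<le> \<phi> x \<sigma>"
  using semimeasure unfolding semimeasure_def by blast

lemma bdd_below_reg: "bdd_below ((\<lambda>y. \<phi> y \<sigma> + real k / 2 ^ length \<sigma> * dist x y) ` unit_cube)"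
  by (rule bdd_belowI2[of _ 0]) (simp add: nonneg)

lemma reg_le: "y \<in> unit_cube \<Longrightarrow> reg k x \<sigma> \<le> \<phi> y \<sigma> + k / 2 ^ length \<sigma> * dist x y"
  unfolding reg_def by (rule cINF_lower[OF bdd_below_reg])

lemma le_reg: "(\<And>y. y \<in> unit_cube \<Longrightarrow> a \<le> \<phi> y \<sigma> + k / 2 ^ length \<sigma> * dist x y) \<Longrightarrow> a \<le> reg k x \<sigma>"
  unfolding reg_def by (rule cINF_greatest[OF unit_cube_nonempty])

lemma semimeasure_reg:
  assumes "x \<in> unit_cube"
  shows "semimeasure (reg k x)"
  unfolding semimeasure_def
proof (intro allI conjI)
  fix \<sigma>
  show "0 \<le> reg k x \<sigma>" by (rule le_reg) (simp add: nonneg)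
  have "\<phi> x \<sigma> \<le> 1" using semimeasure[OF assms] by (auto simp: semimeasure_def)
  then show "reg k x \<sigma> \<le> 1" using reg_le[OF assms, of k x \<sigma>] by simp
  show "reg k x (\<sigma> @ [False]) + reg k x (\<sigma> @ [True]) \<le> reg k x \<sigma>"
  proof (rule le_reg)
    fix y :: "bool list \<Rightarrow> real" assume y: "y \<in> unit_cube"
    have "\<phi> y (\<sigma> @ [False]) + \<phi> y (\<sigma> @ [True]) \<le> \<phi> y \<sigma>"
      using semimeasure[OF y] unfolding semimeasure_def by blast
    moreover have halves: "k / 2 ^ length \<sigma> * dist x y =
        k / 2 ^ length (\<sigma> @ [False]) * dist x y + k / 2 ^ length (\<sigma> @ [True]) * dist x y"
      by (simp add: field_simps)
    ultimately show "reg k x (\<sigma> @ [False]) + reg k x (\<sigma> @ [True]) \<le> \<phi> y \<sigma> + k / 2 ^ length \<sigma> * dist x y"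
      using reg_le[OF y, of k x "\<sigma> @ [False]"] reg_le[OF y, of k x "\<sigma> @ [True]"] by linarith
  qed
qed

text \<open>An infimum of functions with a common Lipschitz constant has that constant as
  well.\<close>

lemma continuous_on_reg: "continuous_on A (\<lambda>x. reg k x \<sigma>)"
proof -
  define L :: real where "L = k / 2 ^ length \<sigma>"
  have "0 \<le> L" by (simp add: L_def)
  have *: "reg k x \<sigma> - L * dist x y \<le> reg k y \<sigma>" for x y
  proof (rule le_reg, unfold L_def[symmetric])
    fix z :: "bool list \<Rightarrow> real" assume "z \<in> unit_cube"
    moreover have "L * dist x z \<le> L * (dist x y + dist y z)"
      by (intro mult_left_mono dist_triangle \<open>0 \<le> L\<close>)
    ultimately show "reg k x \<sigma> - L * dist x y \<le> \<phi> z \<sigma> + L * dist y z"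
      using reg_le[of z k x \<sigma>] by (simp add: distrib_left flip: L_def)
  qed
  have "L-lipschitz_on A (\<lambda>x. reg k x \<sigma>)"
  proof (rule lipschitz_onI)
    show "dist (reg k x \<sigma>) (reg k y \<sigma>) \<le> L * dist x y" for x y
      using *[of x y] *[of y x] by (auto simp: dist_real_def abs_le_iff dist_commute)
  qed (rule \<open>0 \<le> L\<close>)
  then show ?thesis by (rule lipschitz_on_continuous_on)
qed

text \<open>A zero of \<open>?c x (\<sigma> @ [False]) - x \<sigma> * ?c x \<sigma>\<close> says
  that \<open>x \<sigma>\<close> is a conditional probability of the filled measure, with no
  division at null nodes. On the face \<open>x \<sigma> = 0\<close> the expression is the mass of
  the left child, and on \<open>x \<sigma> = 1\<close> it is minus that of the right child, so the
  signs are those of Poincare-Miranda.\<close>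

lemma exists_cyl_prob_ge_reg: "\<exists>x\<in>unit_cube. \<forall>\<sigma>. reg k x \<sigma> \<le> cyl_prob x \<sigma>"
proof -
  let ?c = "\<lambda>x. filling (reg k x)"
  have proj: "continuous_on unit_cube (\<lambda>x :: bool list \<Rightarrow> real. x \<sigma>)" for \<sigma>
    by (rule continuous_on_product_then_coordinatewise[OF continuous_on_id])
  obtain x where x: "x \<in> unit_cube" and zero: "\<And>\<sigma>. ?c x (\<sigma> @ [False]) - x \<sigma> * ?c x \<sigma> = 0"
  proof (rule poincare_miranda_cube[of "\<lambda>x \<sigma>. ?c x (\<sigma> @ [False]) - x \<sigma> * ?c x \<sigma>"])
    show "continuous_on unit_cube (\<lambda>x. ?c x (\<sigma> @ [False]) - x \<sigma> * ?c x \<sigma>)" for \<sigma>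
      by (intro continuous_intros continuous_on_filling continuous_on_reg proj)
  next
    fix x :: "bool list \<Rightarrow> real" and \<sigma> assume "x \<in> unit_cube"
    note nonneg = filling_nonneg[OF semimeasure_reg[OF this]]
    show "x \<sigma> = 0 \<Longrightarrow> 0 \<le> ?c x (\<sigma> @ [False]) - x \<sigma> * ?c x \<sigma>" using nonneg by simp
    show "x \<sigma> = 1 \<Longrightarrow> ?c x (\<sigma> @ [False]) - x \<sigma> * ?c x \<sigma> \<le> 0"
      using filling_additive[of "reg k x" \<sigma>] nonneg[of k "\<sigma> @ [True]"] by simp
  qed blast
  have "cyl_prob x \<sigma> = ?c x \<sigma>" for \<sigma>
  proof (induction \<sigma> rule: rev_induct)
    case (snoc b \<sigma>)
    then show ?case
      using zero[of \<sigma>] filling_additive[of "reg k x" \<sigma>] by (cases b) (auto simp: algebra_simps)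
  qed simp
  then show ?thesis using x filling_ge[OF semimeasure_reg[OF x, of k]] by (intro bexI[OF _ x]) simp
qed

text \<open>Solutions \<open>c k\<close> for the regularizations accumulate at \<open>x\<close>.
  Whenever \<open>a < \<phi> x \<sigma>\<close>, the regularizations at these points are eventually
  at least \<open>a\<close>, and the inequality for \<open>c k\<close> passes to the limit.\<close>

theorem exists_cyl_prob_ge: "\<exists>x\<in>unit_cube. \<forall>\<sigma>. \<phi> x \<sigma> \<le> cyl_prob x \<sigma>"
proof -
  obtain c where c: "\<And>k. c k \<in> unit_cube" "\<And>k \<sigma>. reg k (c k) \<sigma> \<le> cyl_prob (c k) \<sigma>"
    using exists_cyl_prob_ge_reg by metis
  obtain x r where x: "x \<in> unit_cube" and r: "strict_mono r" and lim: "(c \<circ> r) \<longlonglongrightarrow> x"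
    using compact_imp_seq_compact[OF compact_unit_cube] c(1) unfolding seq_compact_def by metis
  have "\<phi> x \<sigma> \<le> cyl_prob x \<sigma>" for \<sigma>
  proof (rule dense_le)
    fix a assume "a < \<phi> x \<sigma>"
    then obtain \<delta> where \<delta>: "\<delta> > 0" "\<And>y. y \<in> unit_cube \<Longrightarrow> dist x y < \<delta> \<Longrightarrow> a < \<phi> y \<sigma>"
      using lsc[OF x] by blast
    have cyl_lim: "(\<lambda>n. cyl_prob (c (r n)) \<sigma>) \<longlonglongrightarrow> cyl_prob x \<sigma>"
      using continuous_on_cyl_prob[of UNIV \<sigma>] lim unfolding continuous_on_sequentially o_def by blast
    \<comment> \<open>From this index on, a distance of \<open>\<delta> / 2\<close> costs a penalty
      of at least 1. Points of the ball around \<open>x\<close> have values above \<open>a\<close>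
      anyway, and for all others the penalty alone exceeds \<open>a\<close>, since
      \<open>a < \<phi> x \<sigma>\<close> and \<open>\<phi> x \<sigma>\<close> is at most
      1.\<close>
    obtain m :: nat where m: "2 * 2 ^ length \<sigma> / \<delta> \<le> m" using real_arch_simple by blast
    have "\<forall>\<^sub>F n in sequentially. dist (c (r n)) x < \<delta> / 2"
      using lim \<delta>(1) unfolding tendsto_iff o_def by (meson half_gt_zero)
    then have "\<forall>\<^sub>F n in sequentially. a \<le> cyl_prob (c (r n)) \<sigma>"
      using eventually_ge_at_top[of m]
    proof eventually_elim
      case (elim n)
      have "m \<le> r n" using elim(2) seq_suble[OF r, of n] by simp
      then have "2 * 2 ^ length \<sigma> / \<delta> \<le> r n" using m by linarith
      then have r_n: "1 \<le> r n / 2 ^ length \<sigma> * (\<delta> / 2)" using \<delta>(1) by (simp add: field_simps)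
      have "a \<le> reg (r n) (c (r n)) \<sigma>"
      proof (rule le_reg)
        fix y :: "bool list \<Rightarrow> real" assume y: "y \<in> unit_cube"
        show "a \<le> \<phi> y \<sigma> + r n / 2 ^ length \<sigma> * dist (c (r n)) y"
        proof (cases "dist x y < \<delta>")
          case True
          have "0 \<le> r n / 2 ^ length \<sigma> * dist (c (r n)) y" by simp
          then show ?thesis using \<delta>(2)[OF y True] by linarith
        next
          case False
          then have "\<delta> / 2 \<le> dist (c (r n)) y"
            using dist_triangle[of x y "c (r n)"] elim(1) by (simp add: dist_commute)
          then have "r n / 2 ^ length \<sigma> * (\<delta> / 2) \<le> r n / 2 ^ length \<sigma> * dist (c (r n)) y"
            by (rule mult_left_mono) simp
          moreover have "\<phi> x \<sigma> \<le> 1" using semimeasure[OF x] by (auto simp: semimeasure_def)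
          ultimately show ?thesis using r_n nonneg[OF y, of \<sigma>] \<open>a < \<phi> x \<sigma>\<close> by linarith
        qed
      qed
      then show ?case using c(2)[of "r n" \<sigma>] by linarith
    qed
    then show "a \<le> cyl_prob x \<sigma>"
      using tendsto_lowerbound[OF cyl_lim] by simp
  qed
  then show ?thesis using x by blast
qed

end

section \<open>Passing a test\<close>

lemma test_value_eq:
  assumes "semimeasure f" "test_set T \<mu> = undergraph f"
  shows "test_value T \<mu> = f"
  unfolding test_value_def by (rule the_equality) (use assms undergraph_inject in auto)

lemma less_test_value_iff:
  assumes "\<exists>f. semimeasure f \<and> test_set T \<mu> = undergraph f"
  shows "of_rat q < test_value T \<mu> \<sigma> \<longleftrightarrow> (\<sigma>, q) \<in> test_set T \<mu>"
  using assms test_value_eq[of _ T \<mu>] by (auto simp: undergraph_def)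

text \<open>The value of a test is lower semicontinuous because a rule has finitely many strict
  premises, and each is an open condition on the conditional probabilities.\<close>

theorem exists_passing_measure:
  assumes T: "\<And>\<mu>. borel_prob \<mu> \<Longrightarrow> \<exists>f. semimeasure f \<and> test_set T \<mu> = undergraph f"
  obtains \<mu> where "borel_prob \<mu>" "passes \<mu> T"
proof -
  have "\<forall>x. \<exists>\<mu>. x \<in> unit_cube \<longrightarrow> borel_prob \<mu> \<and> (\<forall>\<sigma>. cyl_measure \<mu> \<sigma> = cyl_prob x \<sigma>)"
    by (metis exists_measure_cyl_prob)
  then obtain m where m: "\<And>x. x \<in> unit_cube \<Longrightarrow> borel_prob (m x)"
    "\<And>x \<sigma>. x \<in> unit_cube \<Longrightarrow> cyl_measure (m x) \<sigma> = cyl_prob x \<sigma>"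
    by metis
  interpret lsc_semimeasures "\<lambda>x. test_value T (m x)"
  proof
    fix x :: "bool list \<Rightarrow> real" assume x: "x \<in> unit_cube"
    show "semimeasure (test_value T (m x))"
      using T[OF m(1)[OF x]] test_value_eq by auto
    fix a \<sigma> assume "a < test_value T (m x) \<sigma>"
    then obtain q where q: "a < of_rat q" "of_rat q < test_value T (m x) \<sigma>"
      using of_rat_dense by blast
    then have "(\<sigma>, q) \<in> test_set T (m x)"
      using less_test_value_iff[OF T[OF m(1)[OF x]]] by blast
    then obtain ps where ps: "(ps, \<sigma>, q) \<in> T" "\<forall>(\<tau>, p)\<in>set ps. cyl_prob x \<tau> > of_rat p"
      by (auto simp: test_set_def m(2)[OF x])
    have "\<forall>\<^sub>F y in nhds x. \<forall>c\<in>set ps. of_rat (snd c) < cyl_prob y (fst c)"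
    proof (rule eventually_ball_finite)
      show "\<forall>c\<in>set ps. \<forall>\<^sub>F y in nhds x. of_rat (snd c) < cyl_prob y (fst c)"
      proof
        fix c assume "c \<in> set ps"
        then have "of_rat (snd c) < cyl_prob x (fst c)" using ps(2) by auto
        moreover have "((\<lambda>y. cyl_prob y (fst c)) \<longlongrightarrow> cyl_prob x (fst c)) (nhds x)"
          using continuous_on_cyl_prob[of UNIV "fst c"] tendsto_at_iff_tendsto_nhds[of "\<lambda>y. cyl_prob y (fst c)" x]
          by (simp add: continuous_on_eq_continuous_at isCont_def)
        ultimately show "\<forall>\<^sub>F y in nhds x. of_rat (snd c) < cyl_prob y (fst c)"
          by (rule order_tendstoD(1)[rotated])
      qed
    qed simp
    then obtain \<delta> where \<delta>: "\<delta> > 0" "\<And>y. dist y x < \<delta> \<Longrightarrow> \<forall>c\<in>set ps. of_rat (snd c) < cyl_prob y (fst c)"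
      unfolding eventually_nhds_metric by blast
    have "a < test_value T (m y) \<sigma>" if y: "y \<in> unit_cube" "dist x y < \<delta>" for y
    proof -
      have "(\<sigma>, q) \<in> test_set T (m y)"
        using ps(1) \<delta>(2)[of y] y by (auto simp: test_set_def m(2) dist_commute intro!: exI[of _ ps])
      then have "of_rat q < test_value T (m y) \<sigma>"
        using less_test_value_iff[OF T[OF m(1)[OF y(1)]]] by blast
      then show ?thesis using q(1) by linarith
    qed
    then show "\<exists>\<delta>>0. \<forall>y\<in>unit_cube. dist x y < \<delta> \<longrightarrow> a < test_value T (m y) \<sigma>"
      using \<delta>(1) by blast
  qed
  obtain x where "x \<in> unit_cube" "\<forall>\<sigma>. test_value T (m x) \<sigma> \<le> cyl_prob x \<sigma>"
    using exists_cyl_prob_ge by blast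
  then show ?thesis using that[of "m x"] m by (simp add: passes_def)
qed

section \<open>Antichains of strings\<close>

text \<open>The map \<open>h\<close> lets one notion serve premises (\<open>fst\<close>) and rules
  (\<open>head\<close>). A string is comparable with itself, so such a list has no
  repetitions.\<close>

definition antichain :: "('a \<Rightarrow> bool list) \<Rightarrow> 'a list \<Rightarrow> bool" where
  "antichain h = sorted_wrt (\<lambda>x y. h x \<parallel> h y)"

lemma antichain_iff:
  "antichain h xs \<longleftrightarrow> distinct xs \<and> (\<forall>x\<in>set xs. \<forall>y\<in>set xs. x \<noteq> y \<longrightarrow> h x \<parallel> h y)"
  unfolding antichain_def by (induction xs) (auto simp: parallel_commute)

text \<open>Induction on how far the strings may extend beyond \<open>\<sigma>\<close>. Either
  \<open>\<sigma>\<close> itself occurs, and then it is alone, being comparable with all others, or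
  the next bit splits the list into antichains above the two children.\<close>

lemma sum_list_le_semimeasure:
  assumes "semimeasure f" "antichain h xs" "\<forall>x\<in>set xs. prefix \<sigma> (h x)"
  shows "(\<Sum>x\<leftarrow>xs. f (h x)) \<le> f \<sigma>"
proof -
  have single: "xs = [x]" if "x \<in> set xs" "h x = \<sigma>" "antichain h xs" "\<forall>x\<in>set xs. prefix \<sigma> (h x)" for x xs \<sigma>
  proof -
    have "y = x" if "y \<in> set xs" for y
      using \<open>antichain h xs\<close> \<open>x \<in> set xs\<close> \<open>h x = \<sigma>\<close> \<open>\<forall>x\<in>set xs. prefix \<sigma> (h x)\<close> that
      unfolding antichain_iff parallel_def by blast
    then have "set xs = {x}" using that(1) by blast
    moreover from this have "length xs = 1"
      using that(3) distinct_card[of xs] by (simp add: antichain_iff)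
    ultimately show ?thesis by (cases xs) simp_all
  qed
  obtain n where "\<forall>x\<in>set xs. length (h x) \<le> n"
    using finite_nat_set_iff_bounded_le[of "(\<lambda>x. length (h x)) ` set xs"] by auto
  then have "\<forall>x\<in>set xs. length (h x) \<le> n + length \<sigma>" by (meson trans_le_add1)
  then show ?thesis using assms(2,3)
  proof (induction n arbitrary: \<sigma> xs)
    case 0
    show ?case
    proof (cases xs)
      case (Cons x ys)
      then have "h x = \<sigma>" using 0(1,3) by (auto simp: prefix_def)
      then show ?thesis using single[of x xs \<sigma>] 0(2,3) Cons by simp
    qed (use assms(1) in \<open>auto simp: semimeasure_def\<close>)
  next
    case (Suc n)
    show ?case
    proof (cases "\<exists>x\<in>set xs. h x = \<sigma>")
      case True
      then obtain x where x: "x \<in> set xs" "h x = \<sigma>" by blast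
      then have "xs = [x]" using single[of x xs \<sigma>] Suc.prems(2,3) by blast
      then show ?thesis using x by simp
    next
      case False
      let ?ext = "\<lambda>b x. prefix (\<sigma> @ [b]) (h x)"
      have ext: "?ext False x \<noteq> ?ext True x" if x: "x \<in> set xs" for x
      proof -
        obtain \<tau> where "h x = \<sigma> @ \<tau>" "\<tau> \<noteq> []"
          using Suc.prems(3) False x by (metis append_Nil2 prefixE)
        then show ?thesis by (cases \<tau>) auto
      qed
      have le: "(\<Sum>x\<leftarrow>filter (?ext b) xs. f (h x)) \<le> f (\<sigma> @ [b])" for b
        using Suc.prems(1,2) by (intro Suc.IH) (auto simp: antichain_def sorted_wrt_filter)
      have "(\<Sum>x\<leftarrow>ys. f (h x)) = (\<Sum>x\<leftarrow>filter (?ext False) ys. f (h x)) + (\<Sum>x\<leftarrow>filter (?ext True) ys. f (h x))"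
        if "set ys \<subseteq> set xs" for ys
        using that
      proof (induction ys)
        case (Cons y ys)
        then show ?case using ext[of y] by auto
      qed simp
      from this[of xs] have "(\<Sum>x\<leftarrow>xs. f (h x)) \<le> f (\<sigma> @ [False]) + f (\<sigma> @ [True])"
        using le[of False] le[of True] by simp
      then show ?thesis using assms(1) unfolding semimeasure_def by (meson order_trans)
    qed
  qed
qed

lemma semimeasure_cyl_measure:
  assumes "borel_prob \<mu>"
  shows "semimeasure (cyl_measure \<mu>)"
proof -
  interpret prob_space \<mu> using assms by (simp add: borel_prob_def)
  have sets: "cylinder \<sigma> \<in> sets \<mu>" for \<sigma> using assms cylinder_borel by (simp add: borel_prob_def)
  have "cyl_measure \<mu> (\<sigma> @ [False]) + cyl_measure \<mu> (\<sigma> @ [True]) \<le> cyl_measure \<mu> \<sigma>" for \<sigma>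
  proof -
    have snoc: "cylinder (\<sigma> @ [b]) = {x \<in> cylinder \<sigma>. x (length \<sigma>) = b}" for b
      by (auto simp: cylinder_def nth_append less_Suc_eq)
    have "cyl_measure \<mu> (\<sigma> @ [False]) + cyl_measure \<mu> (\<sigma> @ [True])
        = measure \<mu> (cylinder (\<sigma> @ [False]) \<union> cylinder (\<sigma> @ [True]))"
      by (rule finite_measure_Union[OF sets sets, symmetric]) (auto simp: snoc)
    also have "\<dots> \<le> cyl_measure \<mu> \<sigma>"
      by (rule finite_measure_mono[OF _ sets]) (auto simp: snoc)
    finally show ?thesis .
  qed
  then show ?thesis by (simp add: semimeasure_def)
qed

text \<open>Both the obstruction to satisfying strict lower bounds by a measure and the limit on
  what the heads of a test can demand. The empty list is separate because strictness then comes from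
  \<open>0 < 1\<close>.\<close>

lemma sum_list_less_one:
  fixes B :: "'a list" and v :: "'a \<Rightarrow> rat"
  assumes "semimeasure f" "antichain h B" "\<And>x. x \<in> set B \<Longrightarrow> of_rat (v x) < f (h x)"
  shows "sum_list (map v B) < 1"
proof (cases "B = []")
  case False
  have "of_rat (sum_list (map v B)) = (\<Sum>x\<leftarrow>B. of_rat (v x) :: real)"
    by (induction B) (auto simp: of_rat_add)
  also have "\<dots> < (\<Sum>x\<leftarrow>B. f (h x))"
    using False assms(3) by (induction B rule: list_nonempty_induct) (auto intro: add_strict_mono)
  also have "\<dots> \<le> f []"
    by (rule sum_list_le_semimeasure[OF assms(1,2)]) simp
  also have "\<dots> \<le> 1" using assms(1) by (simp add: semimeasure_def)
  finally show ?thesis by simp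
qed simp

text \<open>Common pattern behind the two semimeasures built from finite families: families above
  the two children concatenate to one above the parent, so attained sums add up.\<close>

lemma semimeasure_Sup:
  fixes V :: "bool list \<Rightarrow> real set"
  assumes "\<And>\<sigma>. 0 \<in> V \<sigma>" "\<And>\<sigma> a. a \<in> V \<sigma> \<Longrightarrow> a \<le> 1"
    and "\<And>\<sigma> a b. a \<in> V (\<sigma> @ [False]) \<Longrightarrow> b \<in> V (\<sigma> @ [True]) \<Longrightarrow> a + b \<in> V \<sigma>"
  shows "semimeasure (\<lambda>\<sigma>. Sup (V \<sigma>))"
  unfolding semimeasure_def
proof (intro allI conjI)
  fix \<sigma>
  have bdd: "bdd_above (V \<sigma>)" for \<sigma> using assms(2) by (auto simp: bdd_above_def)
  show "0 \<le> Sup (V \<sigma>)" by (rule cSup_upper[OF assms(1) bdd])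
  show "Sup (V \<sigma>) \<le> 1" using assms(1,2) by (intro cSup_least) auto
  have ne: "V \<sigma> \<noteq> {}" for \<sigma> using assms(1) by blast
  have "a \<le> Sup (V \<sigma>) - b" if "a \<in> V (\<sigma> @ [False])" "b \<in> V (\<sigma> @ [True])" for a b
    using cSup_upper[OF assms(3)[OF that] bdd] by simp
  then have "Sup (V (\<sigma> @ [False])) \<le> Sup (V \<sigma>) - b" if "b \<in> V (\<sigma> @ [True])" for b
    using that by (intro cSup_least[OF ne]) blast
  then have "Sup (V (\<sigma> @ [True])) \<le> Sup (V \<sigma>) - Sup (V (\<sigma> @ [False]))"
    by (intro cSup_least[OF ne]) (simp add: algebra_simps)
  then show "Sup (V (\<sigma> @ [False])) + Sup (V (\<sigma> @ [True])) \<le> Sup (V \<sigma>)" by simp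
qed

lemma parallel_of_prefix_snoc: "prefix (\<sigma> @ [False]) a \<Longrightarrow> prefix (\<sigma> @ [True]) b \<Longrightarrow> a \<parallel> b"
  by (auto simp: parallel_def prefix_def)

lemma antichain_append:
  assumes "antichain h xs" "antichain h ys"
    "\<forall>x\<in>set xs. prefix (\<sigma> @ [False]) (h x)" "\<forall>y\<in>set ys. prefix (\<sigma> @ [True]) (h y)"
  shows "antichain h (xs @ ys)"
  using assms by (auto simp: antichain_def sorted_wrt_append intro: parallel_of_prefix_snoc)

text \<open>The largest antichain sums form a semimeasure, whose deficit at the root leaves room for
  strictness.\<close>

lemma exists_measure_greater:
  fixes P :: "(bool list \<times> rat) list"
  assumes "\<And>B. set B \<subseteq> set P \<Longrightarrow> antichain fst B \<Longrightarrow> sum_list (map snd B) < 1"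
  obtains \<mu> where "borel_prob \<mu>" "\<forall>(\<sigma>, q)\<in>set P. of_rat q < cyl_measure \<mu> \<sigma>"
proof -
  define V :: "bool list \<Rightarrow> real set" where "V \<sigma> = {of_rat (sum_list (map snd B)) | B. set B \<subseteq> set P \<and> antichain fst B \<and>
    (\<forall>b\<in>set B. prefix \<sigma> (fst b))}" for \<sigma>
  have V0: "0 \<in> V \<sigma>" for \<sigma>
    unfolding V_def by (auto intro!: exI[of _ "[]"] simp: antichain_def)
  have finite: "finite (V \<sigma>)" for \<sigma>
  proof (rule finite_subset)
    show "V \<sigma> \<subseteq> (\<lambda>S. of_rat (sum snd S)) ` Pow (set P)"
      unfolding V_def by (auto simp: antichain_iff sum_list_distinct_conv_sum_set)
  qed simp
  have less1: "a < 1" if "a \<in> V \<sigma>" for a \<sigma>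
    using that assms by (auto simp: V_def)
  let ?m = "\<lambda>\<sigma>. Sup (V \<sigma>)"
  have semi: "semimeasure ?m"
  proof (rule semimeasure_Sup[OF V0])
    fix \<sigma> a b assume "a \<in> V (\<sigma> @ [False])" "b \<in> V (\<sigma> @ [True])"
    then obtain A B where A: "a = of_rat (sum_list (map snd A))" "set A \<subseteq> set P" "antichain fst A"
        "\<forall>x\<in>set A. prefix (\<sigma> @ [False]) (fst x)"
      and B: "b = of_rat (sum_list (map snd B))" "set B \<subseteq> set P" "antichain fst B"
        "\<forall>x\<in>set B. prefix (\<sigma> @ [True]) (fst x)"
      unfolding V_def by blast
    have "antichain fst (A @ B)" by (rule antichain_append[OF A(3) B(3) A(4) B(4)])
    moreover have "\<forall>x\<in>set (A @ B). prefix \<sigma> (fst x)" using A(4) B(4) by (auto dest: append_prefixD)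
    ultimately show "a + b \<in> V \<sigma>"
      unfolding V_def using A(1,2) B(1,2) by (auto simp: of_rat_add intro!: exI[of _ "A @ B"])
  qed (use less1 in force)
  \<comment> \<open>Finitely many sums occur, so the supremum is attained and inherits their strict
    bound.\<close>
  have "?m [] \<in> V []" using finite V0 by (metis cSup_eq_Max Max_in empty_iff)
  then have "?m [] < 1" by (rule less1)
  \<comment> \<open>Spreading the deficit evenly over each level adds a positive amount at every
    node, turning weak bounds into strict ones.\<close>
  define s where "s \<sigma> = ?m \<sigma> + (1 - ?m []) / 2 ^ length \<sigma>" for \<sigma>
  have "semimeasure s"
    unfolding semimeasure_def
  proof (intro allI conjI)
    fix \<sigma>
    show "0 \<le> s \<sigma>" using semi \<open>?m [] < 1\<close> by (simp add: s_def semimeasure_def)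
    have "?m \<sigma> \<le> ?m []"
    proof (rule cSup_subset_mono)
      show "V \<sigma> \<subseteq> V []" unfolding V_def by auto
      show "bdd_above (V [])" using finite by (rule bdd_above_finite)
    qed (use V0 in blast)
    moreover have "(1 - ?m []) / 2 ^ length \<sigma> \<le> 1 - ?m []"
      using \<open>?m [] < 1\<close> by (simp add: divide_le_eq mult_le_cancel_left1)
    ultimately show "s \<sigma> \<le> 1" by (simp add: s_def)
    have "?m (\<sigma> @ [False]) + ?m (\<sigma> @ [True]) \<le> ?m \<sigma>" using semi by (simp add: semimeasure_def)
    moreover have "(1 - ?m []) / 2 ^ length (\<sigma> @ [False]) + (1 - ?m []) / 2 ^ length (\<sigma> @ [True])
        = (1 - ?m []) / 2 ^ length \<sigma>"
      by simp
    ultimately show "s (\<sigma> @ [False]) + s (\<sigma> @ [True]) \<le> s \<sigma>"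
      unfolding s_def by linarith
  qed
  then obtain \<mu> where \<mu>: "borel_prob \<mu>" "\<And>\<sigma>. s \<sigma> \<le> cyl_measure \<mu> \<sigma>"
    by (rule exists_measure_ge) blast
  have "of_rat q < cyl_measure \<mu> \<sigma>" if "(\<sigma>, q) \<in> set P" for \<sigma> q
  proof -
    have "of_rat q \<in> V \<sigma>"
      unfolding V_def using that by (auto intro!: exI[of _ "[(\<sigma>, q)]"] simp: antichain_def)
    then have "of_rat q \<le> ?m \<sigma>" using finite by (intro cSup_upper bdd_above_finite)
    also have "\<dots> < s \<sigma>" using \<open>?m [] < 1\<close> by (simp add: s_def)
    finally show ?thesis using \<mu>(2)[of \<sigma>] by linarith
  qed
  then show ?thesis using that[OF \<mu>(1)] by blast
qed

section \<open>Trimming a computably enumerable set of rules to a test\<close>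

type_synonym rule = "(bool list \<times> rat) list \<times> (bool list \<times> rat)"

abbreviation head :: "rule \<Rightarrow> bool list" where "head r \<equiv> fst (snd r)"
abbreviation bound :: "rule \<Rightarrow> rat" where "bound r \<equiv> snd (snd r)"

definition applies :: "(nat \<Rightarrow> bool) measure \<Rightarrow> rule \<Rightarrow> bool" where
  "applies \<mu> r \<longleftrightarrow> (\<forall>(\<sigma>, q)\<in>set (fst r). of_rat q < cyl_measure \<mu> \<sigma>)"

lemma test_set_iff: "(\<sigma>, q) \<in> test_set T \<mu> \<longleftrightarrow> (\<exists>ps. (ps, \<sigma>, q) \<in> T \<and> applies \<mu> (ps, \<sigma>, q))"
  by (simp add: test_set_def applies_def)

text \<open>A decidable substitute for the condition that the rules whose premises hold at \<open>\<mu>\<close> generate a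
  semimeasure for every \<open>\<mu>\<close>: whenever some heads demand too much mass, so do the premises.\<close>

definition consistent :: "rule list \<Rightarrow> bool" where
  "consistent R \<longleftrightarrow> (\<forall>A\<in>set (List.subseqs R). \<not> antichain head A \<or> \<not> 1 < sum_list (map bound A) \<or>
     (\<exists>B. (\<forall>b\<in>set B. b \<in> set (concat (map fst A))) \<and> antichain fst B \<and> \<not> sum_list (map snd B) < 1))"

text \<open>If the premises hold at some measure, no antichain among them sums to 1 or more, so
  consistency leaves only the bound on the heads.\<close>

lemma consistent_sum_le_one:
  assumes "borel_prob \<mu>" "consistent R" "distinct R" "set A \<subseteq> set R" "antichain head A" "\<forall>r\<in>set A. applies \<mu> r"
  shows "sum_list (map bound A) \<le> 1"
proof (rule ccontr)
  assume "\<not> sum_list (map bound A) \<le> 1"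
  \<comment> \<open>\<open>consistent\<close> inspects sublists of \<open>R\<close> only. An
    antichain is free of repetitions, so listing the same rules in another order changes neither its
    sum nor the antichain property.\<close>
  moreover obtain A' where A': "A' \<in> set (List.subseqs R)" "set A' = set A"
    using subset_subseqs[OF assms(4)] by (metis imageE)
  then have "distinct A'" using subseqs_distinctD assms(3) by blast
  then have "antichain head A'" "sum_list (map bound A') = sum_list (map bound A)"
    using assms(5) A'(2) by (simp_all add: antichain_iff sum_list_distinct_conv_sum_set)
  ultimately obtain B where B: "\<forall>b\<in>set B. b \<in> set (concat (map fst A'))" "antichain fst B" "\<not> sum_list (map snd B) < 1"
    using assms(2) A'(1) unfolding consistent_def by (metis not_le)
  have "of_rat (snd b) < cyl_measure \<mu> (fst b)" if "b \<in> set B" for b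
    using B(1) that assms(6) A'(2) by (fastforce simp: applies_def)
  then show False using sum_list_less_one[OF semimeasure_cyl_measure[OF assms(1)] B(2), of snd] B(3) by blast
qed

text \<open>Were the heads to demand more than 1 without an obstruction among the premises, some
  measure would satisfy all premises, and the semimeasure of the test there would exceed 1 along an
  antichain.\<close>

lemma consistent_of_test:
  assumes T: "\<And>\<mu>. borel_prob \<mu> \<Longrightarrow> \<exists>f. semimeasure f \<and> test_set T \<mu> = undergraph f"
    and "set R \<subseteq> T"
  shows "consistent R"
  unfolding consistent_def
proof (rule ballI, rule ccontr)
  fix A assume A: "A \<in> set (List.subseqs R)"
    "\<not> (\<not> antichain head A \<or> \<not> 1 < sum_list (map bound A) \<or>
     (\<exists>B. (\<forall>b\<in>set B. b \<in> set (concat (map fst A))) \<and> antichain fst B \<and> \<not> sum_list (map snd B) < 1))"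
  then have anti: "antichain head A" and gt: "1 < sum_list (map bound A)"
    and B: "\<And>B. set B \<subseteq> set (concat (map fst A)) \<Longrightarrow> antichain fst B \<Longrightarrow> sum_list (map snd B) < 1"
    by blast+
  obtain \<mu> where \<mu>: "borel_prob \<mu>" "\<forall>(\<sigma>, q)\<in>set (concat (map fst A)). of_rat q < cyl_measure \<mu> \<sigma>"
    by (rule exists_measure_greater[OF B]) blast+
  obtain f where f: "semimeasure f" "test_set T \<mu> = undergraph f" using T[OF \<mu>(1)] by blast
  have "set A \<subseteq> T" using A(1) assms(2) subseqs_powset[of R] by blast
  have "of_rat (bound r) < f (head r)" if "r \<in> set A" for r
  proof -
    have "(head r, bound r) \<in> test_set T \<mu>"
      unfolding test_set_iff using that \<mu>(2) \<open>set A \<subseteq> T\<close> by (intro exI[of _ "fst r"]) (auto simp: applies_def)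
    then show ?thesis by (simp add: f(2) undergraph_def case_prod_unfold)
  qed
  then show False using sum_list_less_one[OF f(1) anti, of bound] gt by force
qed

lemma semidecidable_not [semi_intros]: "computable P \<Longrightarrow> semidecidable (\<lambda>x. \<not> P x)"
  by (intro semidecidable_computable comp_intros)

lemma computable_parallel [comp_intros]:
  "computable f \<Longrightarrow> computable g \<Longrightarrow> computable (\<lambda>x. f x \<parallel> g x)"
  unfolding parallel_def by (intro comp_intros)

lemma computable_antichain [comp_intros]:
  assumes "computable h" "computable l"
  shows "computable (\<lambda>x. antichain h (l x))"
  unfolding antichain_def
  by (intro comp_intros assms(2) computable_comp[OF assms(1)])

text \<open>The quantifier over \<open>B\<close> ranges over all lists, and a search for
  \<open>B\<close> is enough here because \<open>trimmed\<close> is an existential condition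
  anyway.\<close>

lemma semidecidable_consistent: "semidecidable consistent"
  unfolding consistent_def
  by (intro semi_intros semidecidable_computable[OF computable_antichain] comp_intros)

section \<open>Stages of a uniform enumeration and their consistency\<close>

definition enumerates :: "nat \<times> rule \<Rightarrow> nat \<Rightarrow> bool" where
  "enumerates = (SOME K. computable (\<lambda>p. K (fst p) (snd p)) \<and>
     (\<forall>x. universal_pred (fst x) (enc (snd x)) \<longleftrightarrow> (\<exists>n. K x n)))"

lemma computable_enumerates: "computable (\<lambda>p. enumerates (fst p) (snd p))"
  and enumerates: "universal_pred e (enc r) \<longleftrightarrow> (\<exists>n. enumerates (e, r) n)"
proof -
  have "semidecidable (\<lambda>x :: nat \<times> rule. universal_pred (fst x) (enc (snd x)))"
    using semidecidable_comp[OF semidecidable_universal_pred, of "\<lambda>x. (fst x, enc (snd x))"]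
    by (simp add: computable_Pair computable_fst computable_snd computable_enc computable_id)
  then have "\<exists>K :: nat \<times> rule \<Rightarrow> nat \<Rightarrow> bool. computable (\<lambda>p. K (fst p) (snd p)) \<and>
     (\<forall>x. universal_pred (fst x) (enc (snd x)) \<longleftrightarrow> (\<exists>n. K x n))"
    unfolding semidecidable_def .
  from someI_ex[OF this] have *: "computable (\<lambda>p. enumerates (fst p) (snd p)) \<and>
      (\<forall>x. universal_pred (fst x) (enc (snd x)) \<longleftrightarrow> (\<exists>n. enumerates x n))"
    unfolding enumerates_def[symmetric] .
  then show "computable (\<lambda>p. enumerates (fst p) (snd p))" by (rule conjunct1)
  show "universal_pred e (enc r) \<longleftrightarrow> (\<exists>n. enumerates (e, r) n)"
    using spec[OF conjunct2[OF *], of "(e, r)"] by simp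
qed

text \<open>Phrased as a checkable property of a list instead of a function that computes it; the
  condition \<open>enc (dec n) = n\<close> skips numbers that code no rule.\<close>

definition stage :: "nat \<Rightarrow> nat \<Rightarrow> rule list \<Rightarrow> bool" where
  "stage e s R \<longleftrightarrow> distinct R \<and> (\<forall>r\<in>set R. enc r < s \<and> (\<exists>m<s. enumerates (e, r) m)) \<and>
     (\<forall>n<s. enc (dec n :: rule) = n \<longrightarrow> (\<exists>m<s. enumerates (e, dec n) m) \<longrightarrow> dec n \<in> set R)"

lemma stage_iff:
  "stage e s R \<longleftrightarrow> distinct R \<and> set R = {r. enc r < s \<and> (\<exists>m<s. enumerates (e, r) m)}"
proof
  assume "stage e s R"
  then have R: "distinct R" "\<And>r. r \<in> set R \<Longrightarrow> enc r < s \<and> (\<exists>m<s. enumerates (e, r) m)"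
    and complete: "\<And>n. n < s \<Longrightarrow> enc (dec n :: rule) = n \<Longrightarrow> \<exists>m<s. enumerates (e, dec n) m \<Longrightarrow> dec n \<in> set R"
    unfolding stage_def by blast+
  have "r \<in> set R" if "enc r < s" "\<exists>m<s. enumerates (e, r) m" for r
    using complete[of "enc r"] that by simp
  then show "distinct R \<and> set R = {r. enc r < s \<and> (\<exists>m<s. enumerates (e, r) m)}" using R by blast
next
  assume R: "distinct R \<and> set R = {r. enc r < s \<and> (\<exists>m<s. enumerates (e, r) m)}"
  then have "dec n \<in> set R" if "n < s" "enc (dec n :: rule) = n" "\<exists>m<s. enumerates (e, dec n) m" for n
    using that by simp
  then show "stage e s R" using R unfolding stage_def by blast
qed

text \<open>The union of all consistent stages: an enumeration that becomes inconsistent contributes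
  only what appeared in its consistent stages.\<close>

definition trimmed :: "nat \<Rightarrow> rule \<Rightarrow> bool" where
  "trimmed e r \<longleftrightarrow> (\<exists>s R. stage e s R \<and> consistent R \<and> r \<in> set R)"

lemma semidecidable_trimmed: "semidecidable (\<lambda>p. trimmed (fst p) (snd p))"
proof -
  have "computable (\<lambda>q :: nat \<times> nat \<times> rule list. stage (fst q) (fst (snd q)) (snd (snd q)))"
    unfolding stage_def by (intro comp_intros computable_comp2[OF computable_enumerates])
  then have "semidecidable (\<lambda>q :: nat \<times> nat \<times> rule list. stage (fst q) (fst (snd q)) (snd (snd q)))"
    by (rule semidecidable_computable)
  from semidecidable_comp[OF this, of "\<lambda>q. (fst (fst (fst q)), snd (fst q), snd q)"] show ?thesis
    unfolding trimmed_def
    by (intro semi_intros semidecidable_comp[OF semidecidable_consistent] comp_intros)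
       (simp add: computable_Pair computable_fst computable_snd computable_id)
qed

text \<open>Stages grow with \<open>s\<close>, so among finitely many consistent stages the largest
  contains the others.\<close>

lemma trimmed_common_stage:
  assumes "\<forall>r\<in>set A. trimmed e r"
  shows "\<exists>s R. stage e s R \<and> consistent R \<and> set A \<subseteq> set R"
  using assms
proof (induction A)
  case Nil
  have "stage e 0 []" "consistent []" by (auto simp: stage_def consistent_def)
  then show ?case by auto
next
  case (Cons r A)
  then obtain s R s' R' where "stage e s R" "consistent R" "set A \<subseteq> set R"
    "stage e s' R'" "consistent R'" "r \<in> set R'"
    unfolding trimmed_def by auto
  moreover from this have "s \<le> s' \<Longrightarrow> set R \<subseteq> set R'" "s' \<le> s \<Longrightarrow> set R' \<subseteq> set R"
    by (auto simp: stage_iff)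
  ultimately have "set (r # A) \<subseteq> set R \<or> set (r # A) \<subseteq> set R'"
    by (cases "s \<le> s'") auto
  then show ?case using \<open>stage e s R\<close> \<open>consistent R\<close> \<open>stage e s' R'\<close> \<open>consistent R'\<close> by blast
qed

text \<open>If \<open>e\<close> enumerates exactly a test, then all its stages are finite parts of
  that test and hence consistent, so no rule is lost.\<close>

lemma trimmed_of_test:
  assumes T: "\<And>\<mu>. borel_prob \<mu> \<Longrightarrow> \<exists>f. semimeasure f \<and> test_set T \<mu> = undergraph f"
    and e: "\<And>r. r \<in> T \<longleftrightarrow> universal_pred e (enc r)" and "r \<in> T"
  shows "trimmed e r"
proof -
  obtain m where m: "enumerates (e, r) m" using \<open>r \<in> T\<close> e enumerates by blast
  define s where "s = Suc (enc r + m)"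
  let ?S = "{r :: rule. enc r < s \<and> (\<exists>m<s. enumerates (e, r) m)}"
  have "finite {r :: rule. enc r < s}"
    using finite_vimageI[OF finite_lessThan[of s] inj_enc] by (simp add: vimage_def)
  then have "finite ?S" by (rule rev_finite_subset) auto
  then obtain R where R: "set R = ?S" "distinct R" using finite_distinct_list by blast
  then have "stage e s R" by (simp add: stage_iff)
  moreover have "consistent R"
    by (rule consistent_of_test[OF T]) (auto simp: R(1) e enumerates)
  moreover have "r \<in> set R" using m by (auto simp: R(1) s_def intro!: exI[of _ m])
  ultimately show ?thesis unfolding trimmed_def by blast
qed

section \<open>The universal test\<close>

type_synonym item = "nat \<times> rule"

definition weight :: "item \<Rightarrow> rat" where
  "weight i = (1 / 2) ^ Suc (fst i) * bound (snd i)"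

text \<open>Incomparability is required only between heads of equal index: within one index a family
  stands for an antichain sum, while different indices are simply added.\<close>

definition compatible :: "bool list \<Rightarrow> item list \<Rightarrow> bool" where
  "compatible \<sigma> I \<longleftrightarrow> (\<forall>i\<in>set I. trimmed (fst i) (snd i) \<and> prefix \<sigma> (head (snd i))) \<and>
     sorted_wrt (\<lambda>i j. fst i = fst j \<longrightarrow> head (snd i) \<parallel> head (snd j)) I"

text \<open>Bounds strictly below the weighted sum produce an undergraph, that is, a downward closed
  set without a largest element. The empty family supplies all negative bounds.\<close>

definition universal_test :: test where
  "universal_test = {r. \<exists>I. compatible (head r) I \<and> fst r = concat (map (\<lambda>i. fst (snd i)) I) \<and>
     bound r < sum_list (map weight I)}"

lemma sum_list_group:
  fixes w :: "'a \<Rightarrow> 'b::comm_monoid_add" and k :: "'a \<Rightarrow> nat"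
  assumes "\<forall>i\<in>set I. k i < N"
  shows "sum_list (map w I) = (\<Sum>e<N. sum_list (map w (filter (\<lambda>i. k i = e) I)))"
  using assms
proof (induction I)
  case (Cons i I)
  have "(\<Sum>e<N. sum_list (map w (filter (\<lambda>j. k j = e) (i # I))))
      = (\<Sum>e<N. (if e = k i then w i else 0) + sum_list (map w (filter (\<lambda>j. k j = e) I)))"
    by (rule sum.cong) auto
  moreover have "(\<Sum>e<N. if e = k i then w i else 0) = w i"
    using Cons.prems by (subst sum.delta) auto
  ultimately show ?case using Cons by (simp add: sum.distrib)
qed simp

text \<open>Grouped by index, each group is an antichain of rules from one consistent stage, so it
  contributes at most \<open>(1 / 2) ^ Suc e\<close>; the geometric sum stays below 1.\<close>

lemma sum_weight_le_one:
  assumes "borel_prob \<mu>" "compatible \<sigma> I" "\<forall>i\<in>set I. applies \<mu> (snd i)"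
  shows "sum_list (map weight I) \<le> 1"
proof -
  obtain N where N: "\<forall>i\<in>set I. fst i < N"
    using finite_nat_set_iff_bounded[of "fst ` set I"] by auto
  have le: "sum_list (map weight (filter (\<lambda>i. fst i = e) I)) \<le> (1 / 2) ^ Suc e" for e
  proof -
    let ?A = "map snd (filter (\<lambda>i. fst i = e) I)"
    have "\<forall>r\<in>set ?A. trimmed e r" using assms(2) by (auto simp: compatible_def)
    then obtain s R where R: "stage e s R" "consistent R" "set ?A \<subseteq> set R"
      using trimmed_common_stage by blast
    have "sorted_wrt (\<lambda>i j. fst i = fst j \<longrightarrow> head (snd i) \<parallel> head (snd j)) (filter (\<lambda>i. fst i = e) I)"
      using assms(2) by (simp add: compatible_def sorted_wrt_filter)
    then have "antichain head ?A"
      unfolding antichain_def sorted_wrt_map by (rule sorted_wrt_mono_rel[rotated]) auto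
    then have "sum_list (map bound ?A) \<le> 1"
      using R assms(1,3) by (intro consistent_sum_le_one[of \<mu> R]) (auto simp: stage_def)
    moreover have "sum_list (map weight (filter (\<lambda>i. fst i = e) I)) = (1 / 2) ^ Suc e * sum_list (map bound ?A)"
      by (induction I) (auto simp: weight_def distrib_left)
    ultimately show ?thesis by (simp add: mult_left_le)
  qed
  have "sum_list (map weight I) = (\<Sum>e<N. sum_list (map weight (filter (\<lambda>i. fst i = e) I)))"
    by (rule sum_list_group[OF N])
  also have "\<dots> \<le> (\<Sum>e<N. (1 / 2) ^ Suc e)" by (intro sum_mono le)
  also have "\<dots> = 1 - (1 / 2) ^ N" by (induction N) auto
  also have "\<dots> \<le> (1 :: rat)" by simp
  finally show ?thesis .
qed

lemma test_set_universal_test: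
  "(\<sigma>, q) \<in> test_set universal_test \<mu> \<longleftrightarrow>
     (\<exists>I. compatible \<sigma> I \<and> (\<forall>i\<in>set I. applies \<mu> (snd i)) \<and> q < sum_list (map weight I))"
proof -
  have "applies \<mu> (concat (map (\<lambda>i. fst (snd i)) I), c) \<longleftrightarrow> (\<forall>i\<in>set I. applies \<mu> (snd i))" for I :: "item list" and c
    by (simp add: applies_def)
  then show ?thesis by (auto simp: test_set_iff universal_test_def)
qed

text \<open>The value at \<open>\<sigma>\<close> is the supremum of the weighted sums of applicable
  compatible families. Families above different children are compatible with each other because
  their heads are incomparable.\<close>

lemma universal_test_semimeasure:
  assumes "borel_prob \<mu>"
  shows "\<exists>f. semimeasure f \<and> test_set universal_test \<mu> = undergraph f"
proof -
  define V :: "bool list \<Rightarrow> real set"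
    where "V \<sigma> = {of_rat (sum_list (map weight I)) | I. compatible \<sigma> I \<and> (\<forall>i\<in>set I. applies \<mu> (snd i))}" for \<sigma>
  have V0: "0 \<in> V \<sigma>" for \<sigma> unfolding V_def by (auto intro!: exI[of _ "[]"] simp: compatible_def)
  have V1: "a \<le> 1" if "a \<in> V \<sigma>" for a \<sigma>
    using that sum_weight_le_one[OF assms] by (auto simp: V_def)
  have "semimeasure (\<lambda>\<sigma>. Sup (V \<sigma>))"
  proof (rule semimeasure_Sup[OF V0 V1])
    fix \<sigma> a b assume "a \<in> V (\<sigma> @ [False])" "b \<in> V (\<sigma> @ [True])"
    then obtain I J where I: "a = of_rat (sum_list (map weight I))" "compatible (\<sigma> @ [False]) I" "\<forall>i\<in>set I. applies \<mu> (snd i)"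
      and J: "b = of_rat (sum_list (map weight J))" "compatible (\<sigma> @ [True]) J" "\<forall>i\<in>set J. applies \<mu> (snd i)"
      unfolding V_def by blast
    have "compatible \<sigma> (I @ J)"
      using I(2) J(2) parallel_of_prefix_snoc[of \<sigma>] unfolding compatible_def
      by (auto simp: sorted_wrt_append dest: append_prefixD)
    moreover have "\<forall>i\<in>set (I @ J). applies \<mu> (snd i)" using I(3) J(3) by (simp add: ball_Un)
    moreover have "a + b = of_rat (sum_list (map weight (I @ J)))" by (simp add: I(1) J(1) of_rat_add)
    ultimately show "a + b \<in> V \<sigma>" unfolding V_def by blast
  qed
  moreover have "(\<sigma>, q) \<in> test_set universal_test \<mu> \<longleftrightarrow> of_rat q < Sup (V \<sigma>)" for \<sigma> q
  proof -
    have "of_rat q < Sup (V \<sigma>) \<longleftrightarrow> (\<exists>a\<in>V \<sigma>. of_rat q < a)"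
      using V0 V1 by (intro less_cSup_iff) (auto simp: bdd_above_def)
    then show ?thesis unfolding test_set_universal_test V_def by (auto simp: of_rat_less)
  qed
  ultimately show ?thesis by (intro exI[of _ "\<lambda>\<sigma>. Sup (V \<sigma>)"]) (auto simp: undergraph_def)
qed

text \<open>The codings of the type class agree with the fixed codings of rules and boxes, so
  results about \<open>enc\<close> become statements about computable enumerability in the required
  sense.\<close>

lemma enc_rule: "enc r = code_rule r"
  and enc_box: "enc w = code_box w"
proof -
  have string: "enc \<sigma> = code_string \<sigma>" for \<sigma>
    by (simp add: enc_list_def code_string_def enc_bool_def[abs_def])
  have rat: "enc q = code_rat q" for q
    by (simp add: enc_rat_def code_rat_def enc_prod_def enc_int_def case_prod_unfold)
  have pair: "(enc :: bool list \<times> rat \<Rightarrow> nat) = code_pair"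
    by (rule ext) (simp add: code_pair_def enc_prod_def string rat case_prod_unfold)
  show "enc r = code_rule r"
    by (simp add: code_rule_def enc_prod_def[of r] enc_list_def pair case_prod_unfold)
  have triple: "enc = (\<lambda>t :: bool list \<times> rat \<times> rat.
      prod_encode (code_string (fst t), prod_encode (code_rat (fst (snd t)), code_rat (snd (snd t)))))"
    by (rule ext) (simp add: enc_prod_def string rat)
  show "enc w = code_box w"
    by (simp add: code_box_def enc_list_def triple case_prod_unfold)
qed

lemma semidecidable_compatible: "semidecidable (\<lambda>p. compatible (fst p) (snd p))"
  unfolding compatible_def
  by (intro semi_intros semidecidable_comp[OF semidecidable_trimmed] semidecidable_computable comp_intros)

lemma semidecidable_universal_test: "semidecidable (\<lambda>r. r \<in> universal_test)"
proof -
  have less: "semidecidable (\<lambda>p :: rule \<times> item list. bound (fst p) < sum_list (map weight (snd p)))"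
    unfolding weight_def by (intro semidecidable_computable comp_intros)
  have compat: "semidecidable (\<lambda>p :: rule \<times> item list. compatible (head (fst p)) (snd p))"
    using semidecidable_comp[OF semidecidable_compatible, of "\<lambda>p :: rule \<times> item list. (head (fst p), snd p)"]
    by (simp add: computable_Pair computable_fst computable_snd computable_id)
  show ?thesis
    unfolding universal_test_def mem_Collect_eq by (intro semi_intros less compat comp_intros)
qed

text \<open>A test with index \<open>e\<close> survives trimming, and families of a single item
  already reproduce its value scaled by \<open>(1 / 2) ^ Suc e\<close>.\<close>

theorem universal_ce_test_universal_test: "universal_ce_test universal_test"
  unfolding universal_ce_test_def
proof (intro conjI allI impI)
  have "code_rule ` universal_test = enc ` {r. r \<in> universal_test}" by (simp add: enc_rule)
  then show U: "ce_test universal_test"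
    unfolding ce_test_def using universal_test_semimeasure ce_of_semidecidable[OF semidecidable_universal_test]
    by simp
  fix T assume T: "ce_test T"
  then have semi: "\<And>\<mu>. borel_prob \<mu> \<Longrightarrow> \<exists>f. semimeasure f \<and> test_set T \<mu> = undergraph f"
    by (simp add: ce_test_def)
  obtain e where e: "code_rule ` T = {n. universal_pred e n}"
    using T ce_universal_pred unfolding ce_test_def by metis
  have iff: "r \<in> T \<longleftrightarrow> universal_pred e (enc r)" for r
    using inj_image_mem_iff[OF inj_code_rule, of r T] by (simp add: e enc_rule)
  have trimmed: "trimmed e r" if "r \<in> T" for r
    by (rule trimmed_of_test[of T]) (use semi iff that in blast)+
  let ?c = "(1 / 2) ^ Suc e :: rat"
  have "of_rat ?c * test_value T \<mu> \<sigma> \<le> test_value universal_test \<mu> \<sigma>" if \<mu>: "borel_prob \<mu>" for \<mu> \<sigma>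
  proof (rule ccontr)
    assume "\<not> ?thesis"
    then have "test_value universal_test \<mu> \<sigma> / of_rat ?c < test_value T \<mu> \<sigma>"
      by (simp add: divide_less_eq mult.commute)
    \<comment> \<open>Two rationals are needed: \<open>?c * p\<close> must lie strictly below the
      weight \<open>?c * q\<close> of the single item and still above the supposed value of the
      universal test.\<close>
    then obtain p q where p: "test_value universal_test \<mu> \<sigma> / of_rat ?c < of_rat p" "of_rat p < (of_rat q :: real)"
      and q: "of_rat q < test_value T \<mu> \<sigma>"
      using of_rat_dense by metis
    then obtain ps where ps: "(ps, \<sigma>, q) \<in> T" "applies \<mu> (ps, \<sigma>, q)"
      using less_test_value_iff[OF semi[OF \<mu>]] test_set_iff by blast
    let ?I = "[(e, ps, \<sigma>, q)]"
    have "compatible \<sigma> ?I" using trimmed[OF ps(1)] by (simp add: compatible_def)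
    moreover have "?c * p < sum_list (map weight ?I)" using p(2) by (simp add: weight_def of_rat_less)
    ultimately have "(\<sigma>, ?c * p) \<in> test_set universal_test \<mu>"
      unfolding test_set_universal_test using ps(2) by (intro exI[of _ ?I]) simp
    then have "of_rat (?c * p) < test_value universal_test \<mu> \<sigma>"
      using less_test_value_iff[OF universal_test_semimeasure[OF \<mu>]] by blast
    moreover have "test_value universal_test \<mu> \<sigma> < of_rat ?c * of_rat p"
      using p(1) by (simp add: divide_less_eq mult.commute)
    ultimately show False unfolding of_rat_mult by linarith
  qed
  then show "\<exists>c>0. \<forall>\<mu> \<sigma>. borel_prob \<mu> \<longrightarrow> of_rat c * test_value T \<mu> \<sigma> \<le> test_value universal_test \<mu> \<sigma>"
    by (intro exI[of _ ?c]) simp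
qed

section \<open>The class of measures passing the universal test\<close>

text \<open>Boxes need two-sided bounds, so one-sided conditions are padded by -1 and 2, which all
  masses respect. The restrictions on the bounds keep every interval nondegenerate and exclude no
  witness of failure: its bound exceeds a mass, and its premises lie below masses.\<close>

definition failure_boxes :: "(bool list \<times> rat \<times> rat) list set" where
  "failure_boxes = {w. \<exists>r\<in>universal_test. 0 < bound r \<and> (\<forall>p\<in>set (fst r). snd p < 2) \<and>
     w = (head r, -1, bound r) # map (\<lambda>p. (fst p, snd p, 2)) (fst r)}"

lemma ce_failure_boxes: "ce (code_box ` failure_boxes)"
proof -
  have "semidecidable (\<lambda>w. \<exists>r. r \<in> universal_test \<and> 0 < bound r \<and> (\<forall>p\<in>set (fst r). snd p < 2) \<and>
      w = (head r, -1, bound r) # map (\<lambda>p. (fst p, snd p, 2)) (fst r))"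
  proof (intro semidecidable_ex semidecidable_conj)
    show "semidecidable (\<lambda>p :: (bool list \<times> rat \<times> rat) list \<times> rule. snd p \<in> universal_test)"
      by (intro semidecidable_comp[OF semidecidable_universal_test] comp_intros)
  qed (intro semidecidable_computable comp_intros)+
  from ce_of_semidecidable[OF this] show ?thesis
    by (simp add: failure_boxes_def Bex_def enc_box)
qed

lemma not_passes_iff:
  assumes "borel_prob \<mu>"
  shows "\<not> passes \<mu> universal_test \<longleftrightarrow> (\<exists>w\<in>failure_boxes. \<mu> \<in> basic_open w)"
proof
  interpret prob_space \<mu> using assms by (simp add: borel_prob_def)
  note less_iff = less_test_value_iff[OF universal_test_semimeasure[OF assms]]
  {
    assume "\<not> passes \<mu> universal_test"
    then obtain \<sigma> where "cyl_measure \<mu> \<sigma> < test_value universal_test \<mu> \<sigma>"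
      by (auto simp: passes_def not_le)
    then obtain q where q: "cyl_measure \<mu> \<sigma> < of_rat q" "of_rat q < test_value universal_test \<mu> \<sigma>"
      using of_rat_dense by blast
    then obtain ps where ps: "(ps, \<sigma>, q) \<in> universal_test" "applies \<mu> (ps, \<sigma>, q)"
      using less_iff test_set_iff by blast
    have "0 < (of_rat q :: real)" using q(1) measure_nonneg[of \<mu> "cylinder \<sigma>"] by linarith
    then have "0 < q" by simp
    have prem: "of_rat p < cyl_measure \<mu> \<tau> \<and> p < 2" if "(\<tau>, p) \<in> set ps" for \<tau> p
    proof -
      have *: "of_rat p < cyl_measure \<mu> \<tau>" using ps(2) that by (auto simp: applies_def)
      then have "of_rat p < (2 :: real)" using prob_le_1[of "cylinder \<tau>"] by linarith
      then have "of_rat p < (of_rat 2 :: real)" by simp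
      then show ?thesis using * by (simp only: of_rat_less)
    qed
    let ?w = "(\<sigma>, -1, q) # map (\<lambda>p. (fst p, snd p, 2)) ps"
    have "?w \<in> failure_boxes"
      unfolding failure_boxes_def using ps(1) \<open>0 < q\<close> prem by (auto intro!: bexI[of _ "(ps, \<sigma>, q)"])
    moreover have "\<mu> \<in> basic_open ?w"
    proof -
      have "-1 < cyl_measure \<mu> \<tau>" "cyl_measure \<mu> \<tau> < 2" for \<tau>
        using measure_nonneg[of \<mu> "cylinder \<tau>"] prob_le_1[of "cylinder \<tau>"] by linarith+
      then show ?thesis
        using assms q(1) prem by (auto simp: basic_open_def of_rat_minus)
    qed
    ultimately show "\<exists>w\<in>failure_boxes. \<mu> \<in> basic_open w" by blast
  next
    assume "\<exists>w\<in>failure_boxes. \<mu> \<in> basic_open w"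
    then obtain ps \<sigma> q where r: "(ps, \<sigma>, q) \<in> universal_test"
      and "\<mu> \<in> basic_open ((\<sigma>, -1, q) # map (\<lambda>p. (fst p, snd p, 2)) ps)"
      unfolding failure_boxes_def by auto
    then have "cyl_measure \<mu> \<sigma> < of_rat q" "applies \<mu> (ps, \<sigma>, q)"
      by (auto simp: basic_open_def applies_def)
    moreover from this r have "of_rat q < test_value universal_test \<mu> \<sigma>"
      using less_iff test_set_iff by blast
    ultimately show "\<not> passes \<mu> universal_test" unfolding passes_def by (meson not_le order.strict_trans)
  }
qed

theorem corollary4p4:
  shows "\<exists>P. pi01_class P \<and> P \<noteq> {} \<and> (\<forall>\<mu>\<in>P. neutral \<mu>)"
proof (intro exI conjI)
  \<comment> \<open>Neutrality allows any universal test as witness; fixing a single one makes the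
    class effectively closed.\<close>
  let ?P = "{\<mu>. borel_prob \<mu> \<and> passes \<mu> universal_test}"
  show "?P \<noteq> {}"
    using exists_passing_measure[of universal_test] universal_test_semimeasure by blast
  show "\<forall>\<mu>\<in>?P. neutral \<mu>"
    using universal_ce_test_universal_test by (auto simp: neutral_def)
  have "Collect borel_prob - ?P = (\<Union>w\<in>failure_boxes. basic_open w)"
    using not_passes_iff by (auto simp: basic_open_def)
  moreover have "\<forall>w\<in>failure_boxes. \<forall>(\<sigma>, p, q)\<in>set w. p < q"
    by (auto simp: failure_boxes_def)
  ultimately show "pi01_class ?P"
    unfolding pi01_class_def using ce_failure_boxes by blast
qed

end
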